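(* Let $H$ be a nonzero complex Hilbert space, let $\Omega\subset H$ be a bounded domain and let $u\in\mathcal{PSH}(\Omega)\cap C^2(\overline\Omega)$ be bounded on $\overline\Omega$. Assume: (1) $u\ge\|z\|^2$ on $\partial\Omega$; (2) for every $z\in\Omega$ and every unit vector $x\in H$, \[ \Delta_x(D'D''u(z))\le\Delta_x(I)=1 . \] Then $\|z\|^2-u$ is plurisubharmonic and nonpositive on $\Omega$.
   Context: The inner product of $H$ is linear in the first variable. Plurisubharmonic: for $\Omega\subset H$ open, $\mathcal{PSH}(\Omega)$ is the set of upper semicontinuous $u:\Omega\to[-\infty,\infty)$, not identically $-\infty$ on any component of $\Omega$, such that $u(z)\le\frac1{2\pi}\int_0^{2\pi}u(z+e^{i\theta}h)\,d\theta$ whenever $z\in\Omega$, $h\in H$ and $z+\lambda h\in\Omega$ for all $|\lambda|\le1$. $C^2(\overline\Omega)$ denotes functions on $\overline\Omega$ of class $C^2$ up to the boundary (of class $C^2$ in $\Omega$, with the function and its derivatives up to order two extending continuously to $\overline\Omega$). Levi form: for a $C^2$ function $u$ with second real Fréchet differential $D^2u(a)$, $4D'D''u(a)(s,t)=D^2u(a)(s,t)+D^2u(a)(is,it)+iD^2u(a)(s,it)-iD^2u(a)(is,t)$; this form is identified with the bounded operator $D'D''u(a)$ given by $\langle D'D''u(a)s,t\rangle=D'D''u(a)(s,t)$ (so $D'D''\|z\|^2=I$, the identity). For $u$ plurisubharmonic this operator is positive. Fujii--Seo determinant: for a bounded positive operator $A\ge0$ and a unit vector $x$, $\Delta_x(A):=\exp\bigl(\lim_{\varepsilon\to0^+}\langle\log(A+\varepsilon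 I)x,x\rangle\bigr)$, with $\exp(-\infty)=0$ (this equals $\exp(\langle(\log A)x,x\rangle)$ if $A$ is invertible). *)

theory Defs
  imports "HOL-Analysis.Analysis"
begin

(* Complex Hilbert spaces: the inner product is linear in the FIRST variable, and the underlying
   real Hilbert space carries inner = Re o cinner, so norm x ^ 2 = Re (cinner x x). *)
class complex_hilbert = real_inner + complete_space +
  fixes scaleC :: "complex \<Rightarrow> 'a \<Rightarrow> 'a"  (infixr \<open>*\<^sub>C\<close> 75)
    and cinner :: "'a \<Rightarrow> 'a \<Rightarrow> complex"
  assumes scaleC_add_right: "a *\<^sub>C (x + y) = a *\<^sub>C x + a *\<^sub>C y"
    and scaleC_add_left: "(a + b) *\<^sub>C x = a *\<^sub>C x + b *\<^sub>C x"
    and scaleC_scaleC: "a *\<^sub>C (b *\<^sub>C x) = (a * b) *\<^sub>C x"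
    and scaleR_scaleC: "r *\<^sub>R x = complex_of_real r *\<^sub>C x"
    and cinner_commute: "cinner x y = cnj (cinner y x)"
    and cinner_add_left: "cinner (x + y) z = cinner x z + cinner y z"
    and cinner_scaleC_left: "cinner (a *\<^sub>C x) y = a * cinner x y"
    and inner_cinner: "inner x y = Re (cinner x y)"

instantiation complex :: complex_hilbert
begin

definition scaleC_complex :: "complex \<Rightarrow> complex \<Rightarrow> complex"
  where "scaleC_complex a x = a * x"

definition cinner_complex :: "complex \<Rightarrow> complex \<Rightarrow> complex"
  where "cinner_complex x y = x * cnj y"

instance
  by standard
    (auto simp: scaleC_complex_def cinner_complex_def inner_complex_def algebra_simps
      scaleR_conv_of_real)

end


section \<open>Plurisubharmonic functions\<close>

definition usc_on :: "'a::topological_space set \<Rightarrow> ('a \<Rightarrow> ereal) \<Rightarrow> bool"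
  where "usc_on \<Omega> u \<longleftrightarrow> (\<forall>c. openin (top_of_set \<Omega>) {z \<in> \<Omega>. u z < c})"

(* Lebesgue integral of an extended real function as the difference of the integrals of its positive
   and negative parts; it is only used below for functions that are bounded above on the circle
   (upper semicontinuous, < \<infinity>), for which the first term is finite. *)
definition ereal_integral :: "'b measure \<Rightarrow> ('b \<Rightarrow> ereal) \<Rightarrow> ereal"
  where "ereal_integral M f =
    enn2ereal (\<integral>\<^sup>+ x. e2ennreal (f x) \<partial>M) - enn2ereal (\<integral>\<^sup>+ x. e2ennreal (- f x) \<partial>M)"

definition circle_mean :: "('a::complex_hilbert \<Rightarrow> ereal) \<Rightarrow> 'a \<Rightarrow> 'a \<Rightarrow> ereal"
  where "circle_mean u z h =
    ereal (1 / (2 * pi)) *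
      ereal_integral (restrict_space lborel {0..2*pi}) (\<lambda>\<theta>. u (z + cis \<theta> *\<^sub>C h))"

definition psh :: "'a::complex_hilbert set \<Rightarrow> ('a \<Rightarrow> ereal) \<Rightarrow> bool"
  where "psh \<Omega> u \<longleftrightarrow>
    usc_on \<Omega> u \<and>
    (\<forall>z\<in>\<Omega>. u z < \<infinity>) \<and>
    (\<forall>C\<in>components \<Omega>. \<exists>z\<in>C. u z \<noteq> -\<infinity>) \<and>
    (\<forall>z\<in>\<Omega>. \<forall>h. (\<forall>l. cmod l \<le> 1 \<longrightarrow> z + l *\<^sub>C h \<in> \<Omega>) \<longrightarrow> u z \<le> circle_mean u z h)"


section \<open>Real differentials and the Levi form\<close>

(* u1 and u2 are the continuous extensions to the closure of the first and second real Frechet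
   differentials, continuity being with respect to the operator norms. *)
definition C2_closure :: "'a::real_normed_vector set \<Rightarrow> ('a \<Rightarrow> real) \<Rightarrow> bool"
  where "C2_closure \<Omega> u \<longleftrightarrow>
    (\<exists>(u1 :: 'a \<Rightarrow> 'a \<Rightarrow>\<^sub>L real) (u2 :: 'a \<Rightarrow> 'a \<Rightarrow>\<^sub>L 'a \<Rightarrow>\<^sub>L real).
      (\<forall>z\<in>\<Omega>. (u has_derivative blinfun_apply (u1 z)) (at z)) \<and>
      (\<forall>z\<in>\<Omega>. (u1 has_derivative blinfun_apply (u2 z)) (at z)) \<and>
      continuous_on (closure \<Omega>) u \<and>
      continuous_on (closure \<Omega>) u1 \<and>
      continuous_on (closure \<Omega>) u2)"

definition D1 :: "('a::real_normed_vector \<Rightarrow> real) \<Rightarrow> 'a \<Rightarrow> 'a \<Rightarrow>\<^sub>L real"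
  where "D1 u a = Blinfun (frechet_derivative u (at a))"

definition D2 :: "('a::real_normed_vector \<Rightarrow> real) \<Rightarrow> 'a \<Rightarrow> 'a \<Rightarrow> 'a \<Rightarrow> real"
  where "D2 u a s t = blinfun_apply (frechet_derivative (D1 u) (at a) s) t"

definition levi_form :: "('a::complex_hilbert \<Rightarrow> real) \<Rightarrow> 'a \<Rightarrow> 'a \<Rightarrow> 'a \<Rightarrow> complex"
  where "levi_form u a s t =
    (complex_of_real (D2 u a s t) + complex_of_real (D2 u a (\<i> *\<^sub>C s) (\<i> *\<^sub>C t))
      + \<i> * complex_of_real (D2 u a s (\<i> *\<^sub>C t)) - \<i> * complex_of_real (D2 u a (\<i> *\<^sub>C s) t)) / 4"

(* Bounded operators are represented by the real-linear type 'a \<Rightarrow>\<^sub>L 'a; the operator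
   characterized here is complex linear because the form is complex linear in s. *)
definition levi_op :: "('a::complex_hilbert \<Rightarrow> real) \<Rightarrow> 'a \<Rightarrow> 'a \<Rightarrow>\<^sub>L 'a"
  where "levi_op u a = (THE A. \<forall>s t. cinner (blinfun_apply A s) t = levi_form u a s t)"


section \<open>Continuous functional calculus and the Fujii--Seo determinant\<close>

(* For complex linear A, the (real linear) inverse B of A - l I is automatically complex linear. *)
definition op_spectrum :: "('a::complex_hilbert \<Rightarrow>\<^sub>L 'a) \<Rightarrow> complex set"
  where "op_spectrum A =
    {l. \<not> (\<exists>B :: 'a \<Rightarrow>\<^sub>L 'a.
        (\<forall>x. blinfun_apply B (blinfun_apply A x - l *\<^sub>C x) = x) \<and>
        (\<forall>x. blinfun_apply A (blinfun_apply B x) - l *\<^sub>C blinfun_apply B x = x))}"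

definition op_power :: "('a::complex_hilbert \<Rightarrow>\<^sub>L 'a) \<Rightarrow> nat \<Rightarrow> 'a \<Rightarrow>\<^sub>L 'a"
  where "op_power A n = ((\<lambda>B. A o\<^sub>L B) ^^ n) id_blinfun"

definition op_poly :: "real poly \<Rightarrow> ('a::complex_hilbert \<Rightarrow>\<^sub>L 'a) \<Rightarrow> 'a \<Rightarrow>\<^sub>L 'a"
  where "op_poly p A = (\<Sum>i\<le>degree p. coeff p i *\<^sub>R op_power A i)"

(* Continuous functional calculus f(A) of a self-adjoint operator A and a real function f that is
   continuous on the (real) spectrum of A: the operator norm limit of p n (A) for any real
   polynomials p n converging to f uniformly on the spectrum. *)
definition op_fun :: "(real \<Rightarrow> real) \<Rightarrow> ('a::complex_hilbert \<Rightarrow>\<^sub>L 'a) \<Rightarrow> 'a \<Rightarrow>\<^sub>L 'a"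
  where "op_fun f A = (THE B. \<forall>p :: nat \<Rightarrow> real poly.
    uniform_limit {t. complex_of_real t \<in> op_spectrum A} (\<lambda>n. poly (p n)) f sequentially
      \<longrightarrow> (\<lambda>n. op_poly (p n) A) \<longlonglongrightarrow> B)"

definition ereal_exp :: "ereal \<Rightarrow> ereal"
  where "ereal_exp a = (case a of ereal r \<Rightarrow> ereal (exp r) | PInfty \<Rightarrow> \<infinity> | MInfty \<Rightarrow> 0)"

(* For A \<ge> 0 the operator log (A + e I) is self-adjoint, so its quadratic form is real; the limit
   is taken in the extended reals, as it may be -\<infinity>. *)
definition fujii_seo_det :: "'a::complex_hilbert \<Rightarrow> ('a \<Rightarrow>\<^sub>L 'a) \<Rightarrow> ereal"
  where "fujii_seo_det x A =
    ereal_exp (Lim (at_right 0) (\<lambda>e. ereal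
      (Re (cinner (blinfun_apply (op_fun ln (A + e *\<^sub>R id_blinfun)) x) x))))"


section \<open>The normalizations of the determinant and of the Levi operator\<close>

lemma scaleC_0: "(0::complex) *\<^sub>C (x::'a::complex_hilbert) = 0"
  using scaleC_add_left[of 0 0 x] by simp

lemma cinner_self_norm: "Re (cinner x x) = (norm x)\<^sup>2" for x :: "'a::complex_hilbert"
  by (simp add: inner_cinner[symmetric] power2_norm_eq_inner)

lemma op_spectrum_scalar:
  assumes "\<exists>x::'a::complex_hilbert. x \<noteq> 0"
  shows "op_spectrum (c *\<^sub>R id_blinfun :: 'a \<Rightarrow>\<^sub>L 'a) = {complex_of_real c}"
proof -
  have eq: "c *\<^sub>R x - l *\<^sub>C x = (complex_of_real c - l) *\<^sub>C x" for l and x :: 'a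
    using scaleC_add_left[of "complex_of_real c - l" l x] by (simp add: scaleR_scaleC)
  have lin: "bounded_linear (\<lambda>x::'a. l *\<^sub>C x)" for l
  proof (rule bounded_linear_intro[of _ "cmod l"])
    fix x y :: 'a and r :: real
    show "l *\<^sub>C (x + y) = l *\<^sub>C x + l *\<^sub>C y" by (rule scaleC_add_right)
    show "l *\<^sub>C (r *\<^sub>R x) = r *\<^sub>R (l *\<^sub>C x)"
      by (simp add: scaleR_scaleC scaleC_scaleC mult.commute)
    have r: "cinner x (l *\<^sub>C y) = cnj l * cinner x y" for x y :: 'a
      by (metis cinner_commute cinner_scaleC_left complex_cnj_mult)
    have "(norm (l *\<^sub>C x))\<^sup>2 = Re ((l * cnj l) * cinner x x)"
      by (simp only: cinner_self_norm[symmetric] cinner_scaleC_left r mult.assoc[symmetric])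
        (simp add: algebra_simps)
    also have "\<dots> = (norm x * cmod l)\<^sup>2"
      by (simp only: complex_norm_square[symmetric] Re_complex_of_real cinner_self_norm)
         (simp add: cinner_self_norm power_mult_distrib mult.commute)
    finally show "norm (l *\<^sub>C x) \<le> norm x * cmod l" by (simp add: power2_eq_iff_nonneg)
  qed
  show ?thesis
  proof (intro equalityI subsetI)
    fix l assume "l \<in> op_spectrum (c *\<^sub>R id_blinfun :: 'a \<Rightarrow>\<^sub>L 'a)"
    then have n: "\<not> (\<exists>B :: 'a \<Rightarrow>\<^sub>L 'a.
        (\<forall>x. blinfun_apply B ((complex_of_real c - l) *\<^sub>C x) = x) \<and>
        (\<forall>x. (complex_of_real c - l) *\<^sub>C blinfun_apply B x = x))"
      by (simp add: op_spectrum_def blinfun.scaleR_left eq)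
    show "l \<in> {complex_of_real c}"
    proof (rule ccontr)
      assume "l \<notin> {complex_of_real c}"
      then have "complex_of_real c - l \<noteq> 0" by simp
      moreover have "1 *\<^sub>C x = x" for x :: 'a using scaleR_scaleC[of 1 x] by simp
      ultimately show False
        using n[unfolded not_ex, rule_format, of "Blinfun (\<lambda>x. (1/(complex_of_real c - l)) *\<^sub>C x)"]
        by (simp add: bounded_linear_Blinfun_apply[OF lin] scaleC_scaleC)
    qed
  next
    fix l assume "l \<in> {complex_of_real c}"
    then have "l = complex_of_real c" by simp
    with assms show "l \<in> op_spectrum (c *\<^sub>R id_blinfun :: 'a \<Rightarrow>\<^sub>L 'a)"
      by (auto simp: op_spectrum_def blinfun.scaleR_left eq scaleC_0 blinfun.zero_right)
  qed
qed

lemma op_power_scalar: "op_power (c *\<^sub>R id_blinfun) n = (c ^ n) *\<^sub>R id_blinfun"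
  by (induction n) (auto simp: op_power_def intro!: blinfun_eqI simp: blinfun.scaleR_left)

lemma op_poly_scalar: "op_poly p (c *\<^sub>R id_blinfun) = poly p c *\<^sub>R id_blinfun"
  by (simp add: op_poly_def op_power_scalar poly_altdef scaleR_sum_left)

lemma op_fun_scalar:
  assumes "\<exists>x::'a::complex_hilbert. x \<noteq> 0"
  shows "op_fun f (c *\<^sub>R id_blinfun :: 'a \<Rightarrow>\<^sub>L 'a) = f c *\<^sub>R id_blinfun"
  unfolding op_fun_def op_spectrum_scalar[OF assms] op_poly_scalar
proof (rule the_equality)
  show "\<forall>p. uniform_limit {t. complex_of_real t \<in> {complex_of_real c}} (\<lambda>n. poly (p n)) f sequentially \<longrightarrow>
        (\<lambda>n. poly (p n) c *\<^sub>R id_blinfun) \<longlonglongrightarrow> f c *\<^sub>R (id_blinfun :: 'a \<Rightarrow>\<^sub>L 'a)"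
    by (auto intro!: tendsto_intros dest: tendsto_uniform_limitI)
next
  fix B :: "'a \<Rightarrow>\<^sub>L 'a"
  assume *: "\<forall>p. uniform_limit {t. complex_of_real t \<in> {complex_of_real c}} (\<lambda>n. poly (p n)) f sequentially \<longrightarrow>
        (\<lambda>n. poly (p n) c *\<^sub>R id_blinfun) \<longlonglongrightarrow> B"
  have "uniform_limit {t. complex_of_real t \<in> {complex_of_real c}} (\<lambda>n. poly [:f c:]) f sequentially"
    by (auto simp: uniform_limit_iff)
  with *[rule_format, of "\<lambda>_. [:f c:]"] show "B = f c *\<^sub>R id_blinfun"
    by (simp add: tendsto_const_iff)
qed

lemma fujii_seo_det_id:
  assumes "norm (x::'a::complex_hilbert) = 1"
  shows "fujii_seo_det x id_blinfun = 1"
proof -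
  have nz: "\<exists>x::'a. x \<noteq> 0" using assms by (intro exI[of _ x]) auto
  have 1: "id_blinfun + e *\<^sub>R id_blinfun = (1 + e) *\<^sub>R (id_blinfun :: 'a \<Rightarrow>\<^sub>L 'a)" for e
    by (simp add: scaleR_left_distrib)
  have "((\<lambda>e. ereal (ln (1 + e))) \<longlongrightarrow> ereal (ln (1 + 0))) (at_right 0)"
    by (intro tendsto_intros) auto
  then have "Lim (at_right 0) (\<lambda>e. ereal (ln (1 + e))) = 0"
    by (intro tendsto_Lim) (auto simp: zero_ereal_def)
  moreover have "Re (cinner (blinfun_apply (op_fun ln (id_blinfun + e *\<^sub>R id_blinfun)) x) x) = ln (1 + e)" for e
    by (simp only: 1 op_fun_scalar[OF nz] blinfun.scaleR_left scaleR_scaleC cinner_scaleC_left)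
       (simp add: cinner_self_norm assms)
  ultimately show ?thesis
    by (simp add: fujii_seo_det_def ereal_exp_def zero_ereal_def one_ereal_def)
qed

lemma cinner_add_right: "cinner x (y + z) = cinner x y + cinner x z" for x :: "'a::complex_hilbert"
  by (metis cinner_add_left cinner_commute complex_cnj_add)

lemma levi_op_norm_sq: "levi_op (\<lambda>z::'a::complex_hilbert. (norm z)\<^sup>2) a = id_blinfun"
proof -
  have d: "((\<lambda>z::'a. (norm z)\<^sup>2) has_derivative (\<lambda>s. 2 * inner a s)) (at a)" for a
    unfolding power2_norm_eq_inner
    by (auto intro!: derivative_eq_intros simp: inner_commute)
  have "D1 (\<lambda>z::'a. (norm z)\<^sup>2) a = 2 *\<^sub>R blinfun_inner_right a" for a
    unfolding D1_def frechet_derivative_at[OF d, symmetric]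
    by (rule blinfun_eqI, subst bounded_linear_Blinfun_apply)
       (auto intro!: bounded_linear_intros simp: blinfun.scaleR_left)
  then have D1: "D1 (\<lambda>z::'a. (norm z)\<^sup>2) = (\<lambda>a. 2 *\<^sub>R blinfun_inner_right a)" by auto
  have bl: "bounded_linear (\<lambda>a::'a. 2 *\<^sub>R blinfun_inner_right a)"
    by (intro bounded_linear_intros bounded_linear_blinfun_inner_right)
  have D2: "D2 (\<lambda>z::'a. (norm z)\<^sup>2) a s t = 2 * inner s t" for s t
    unfolding D2_def D1 
    by (subst frechet_derivative_at[OF bounded_linear.has_derivative[OF bl has_derivative_ident], symmetric])
       (simp add: blinfun.scaleR_left)
  have r: "cinner x (l *\<^sub>C y) = cnj l * cinner x y" for x y :: 'a and l
    by (metis cinner_commute cinner_scaleC_left complex_cnj_mult)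
  have L: "levi_form (\<lambda>z::'a. (norm z)\<^sup>2) a s t = cinner s t" for s t
    unfolding levi_form_def D2 inner_cinner 
    by (simp add: cinner_scaleC_left r complex_eq_iff)
  show ?thesis unfolding levi_op_def L
  proof (rule the_equality)
    show "\<forall>s t. cinner (blinfun_apply id_blinfun s) t = cinner s t" by simp
    fix A :: "'a \<Rightarrow>\<^sub>L 'a" assume A: "\<forall>s t. cinner (blinfun_apply A s) t = cinner s t"
    show "A = id_blinfun"
    proof (rule blinfun_eqI)
      fix s
      have "\<forall>t. inner (blinfun_apply A s) t = inner s t" using A by (simp add: inner_cinner)
      then show "blinfun_apply A s = blinfun_apply id_blinfun s"
        by (simp add: vector_eq_rdot) 
    qed
  qed
qed

end

theory Submission
  imports Defs "HOL-Computational_Algebra.Fundamental_Theorem_Algebra"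
begin

text \<open>
  Write \<open>A\<close> for the Levi operator of \<open>u\<close> at a point of the domain. Plurisubharmonicity of \<open>u\<close> makes
  \<open>A\<close> positive. The heart of the matter is that the determinant condition forces \<open>A \<le> I\<close>
  (lemma \<open>form_le_of_fujii_seo_det_le_one\<close>). It is applied to the vectors \<open>x = A y\<close>: from
  \<open>log s \<ge> 1 - 1/s\<close> one has \<open>t\<^sup>2 log (t + \<epsilon>) \<ge> t\<^sup>2 - t\<close> for \<open>t \<ge> 0\<close>, hence
  \<open>A log (A + \<epsilon>) A \<ge> A\<^sup>2 - A\<close> for every \<open>\<epsilon> > 0\<close>. If the limit of
  \<open>\<langle>log (A + \<epsilon>) x, x\<rangle>\<close> is at most \<open>0\<close>, this bound gives
  \<open>\<parallel>A y\<parallel>\<^sup>2 \<le> \<langle>A y, y\<rangle> \<le> \<parallel>A y\<parallel> \<parallel>y\<parallel>\<close>, so \<open>\<parallel>A y\<parallel> \<le> \<parallel>y\<parallel>\<close> and \<open>\<langle>A y, y\<rangle> \<le> \<parallel>y\<parallel>\<^sup>2\<close>. The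
  tools are the monotonicity and the multiplicativity of the continuous functional calculus.

  Consequently \<open>v = \<parallel>z\<parallel>\<^sup>2 - u\<close> has a positive Levi form, that is, a nonnegative Laplacian along every
  complex line, and two classical facts finish the argument. Such a function satisfies the
  sub-mean-value inequality on discs (\<open>mean_value_gap\<close>), so it is plurisubharmonic. And it obeys the
  maximum principle (\<open>maximum_principle\<close>): although the boundary of a bounded domain in \<open>H\<close> need not
  be compact, its intersection with a complex line is, so one may argue on a single line.

  The functional calculus is obtained from one fact about real polynomials \<open>p\<close> and a self-adjoint
  operator \<open>A\<close>: if \<open>p \<ge> 0\<close> on the spectrum, then \<open>p(A) \<ge> 0\<close> (\<open>op_poly_nonneg\<close>). Indeed the infimum
  \<open>m\<close> of the form of \<open>p(A)\<close> on the unit sphere is an approximate eigenvalue, and factoring \<open>p - m\<close> over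
  the complex numbers shows \<open>m = p(t)\<close> for some \<open>t\<close> in the spectrum. The Levi operator itself exists by
  the Riesz representation theorem and is self-adjoint by the symmetry of second derivatives.
\<close>

section \<open>Complex Hilbert spaces\<close>

text \<open>
  This makes the bounded operators a complete space, in which the limits of the functional calculus
  are taken.
\<close>

instance complex_hilbert \<subseteq> banach ..

lemma cinner_scaleC_right: "cinner x (c *\<^sub>C y) = cnj c * cinner x y" for x :: "'a::complex_hilbert"
  by (metis cinner_commute cinner_scaleC_left complex_cnj_mult)

lemma scaleC_one [simp]: "1 *\<^sub>C x = x" for x :: "'a::complex_hilbert"
  using scaleR_scaleC[of 1 x] by simp

lemma inner_scaleC_left: "inner (c *\<^sub>C x) y = inner x (cnj c *\<^sub>C y)" for x :: "'a::complex_hilbert"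
  by (simp add: inner_cinner cinner_scaleC_left cinner_scaleC_right)

lemma norm_scaleC [simp]: "norm (c *\<^sub>C x) = cmod c * norm x" for x :: "'a::complex_hilbert"
proof -
  have "(norm (c *\<^sub>C x))\<^sup>2 = inner x ((cnj c * c) *\<^sub>C x)"
    by (simp add: power2_norm_eq_inner inner_scaleC_left scaleC_scaleC)
  also have "cnj c * c = complex_of_real ((cmod c)\<^sup>2)"
    by (metis complex_norm_square mult.commute)
  also have "inner x (complex_of_real ((cmod c)\<^sup>2) *\<^sub>C x) = (cmod c * norm x)\<^sup>2"
    by (simp add: scaleR_scaleC[symmetric] power_mult_distrib power2_norm_eq_inner del: of_real_power)
  finally show ?thesis by (simp add: power2_eq_iff_nonneg)
qed

lemma bounded_linear_scaleC_right: "bounded_linear (\<lambda>x::'a::complex_hilbert. c *\<^sub>C x)"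
  by (rule bounded_linear_intro[of _ "cmod c"])
     (auto simp: scaleC_add_right scaleR_scaleC scaleC_scaleC mult.commute)

lemma bounded_linear_scaleC_left: "bounded_linear (\<lambda>c. c *\<^sub>C (x::'a::complex_hilbert))"
proof (rule bounded_linear_intro[of _ "norm x"])
  show "(r *\<^sub>R c) *\<^sub>C x = r *\<^sub>R (c *\<^sub>C x)" for r c
    by (simp only: scaleR_scaleC[of r "c *\<^sub>C x"] scaleC_scaleC scaleR_conv_of_real)
qed (auto simp: scaleC_add_left)

lemma ii_scaleC: "\<i> *\<^sub>C \<i> *\<^sub>C x = - x" for x :: "'a::complex_hilbert"
  using scaleR_scaleC[of "-1" x] by (simp add: scaleC_scaleC)

text \<open>
  The representing vector is the minimizer of \<open>\<parallel>x\<parallel>\<^sup>2 - 2 f x\<close>. By the parallelogram law a minimizing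
  sequence is Cauchy, and at the minimum the first variation vanishes, which is the claim.
\<close>

lemma riesz_representation:
  fixes f :: "'a::{real_inner,complete_space} \<Rightarrow> real"
  assumes f: "bounded_linear f"
  shows "\<exists>v. \<forall>x. f x = inner v x"
proof -
  interpret f: bounded_linear f by fact
  define J where "J x = (norm x)\<^sup>2 - 2 * f x" for x
  obtain K where K: "\<And>x. norm (f x) \<le> norm x * K" using f.bounded by auto
  have lb: "- K\<^sup>2 \<le> J x" for x
  proof -
    have "2 * f x \<le> 2 * (norm x * K)" using K[of x] by simp
    moreover have "0 \<le> (norm x - K)\<^sup>2" by simp
    ultimately show ?thesis by (simp add: J_def power2_diff)
  qed
  then have bdd: "bdd_below (range J)" by (auto intro!: bdd_belowI)
  define d where "d = Inf (range J)"
  have dJ: "d \<le> J x" for x unfolding d_def by (rule cInf_lower[OF _ bdd]) auto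
  have "\<exists>x. J x < d + 1 / real (Suc n)" for n
    using cInf_lessD[of "range J" "d + 1 / real (Suc n)"] unfolding d_def by auto
  then obtain X where X: "\<And>n. J (X n) < d + 1 / real (Suc n)" by metis
  have par: "(norm (x - y))\<^sup>2 \<le> 2 * ((J x - d) + (J y - d))" for x y
  proof -
    define m where "m = (1/2) *\<^sub>R (x + y)"
    have "J x + J y - 2 * J m = (norm (x - y))\<^sup>2 / 2"
      unfolding J_def power2_norm_eq_inner m_def
      by (simp add: f.scaleR f.add inner_add_left inner_add_right inner_diff_left inner_diff_right
          inner_commute field_simps)
    moreover have "n \<le> 2 * ((a - D) + (b - D))" if "a + b - 2 * M = n / 2" "D \<le> M" for a b n D M :: real
      using that by argo
    ultimately show ?thesis using dJ[of m] by blast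
  qed
  have inv0: "(\<lambda>n. 1 / real (Suc n)) \<longlonglongrightarrow> 0" by (rule LIMSEQ_Suc[OF lim_1_over_n])
  have "Cauchy X"
  proof (rule metric_CauchyI)
    fix e :: real assume e: "0 < e"
    then have "\<forall>\<^sub>F n in sequentially. 1 / real (Suc n) < e\<^sup>2 / 4"
      by (intro order_tendstoD(2)[OF inv0]) auto
    then obtain N where N: "\<And>n. n \<ge> N \<Longrightarrow> 1 / real (Suc n) < e\<^sup>2 / 4"
      by (auto simp: eventually_sequentially)
    have "dist (X m) (X n) < e" if "m \<ge> N" "n \<ge> N" for m n
    proof -
      have "(norm (X m - X n))\<^sup>2 < e\<^sup>2"
        using par[of "X m" "X n"] X[of m] X[of n] N[OF that(1)] N[OF that(2)] by argo
      then show ?thesis using e by (simp add: dist_norm power_less_imp_less_base)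
    qed
    then show "\<exists>M. \<forall>m\<ge>M. \<forall>n\<ge>M. dist (X m) (X n) < e" by blast
  qed
  then obtain v where v: "X \<longlonglongrightarrow> v" by (auto simp: Cauchy_convergent_iff convergent_def)
  have "(\<lambda>n. J (X n)) \<longlonglongrightarrow> J v" unfolding J_def by (intro tendsto_intros f.tendsto v)
  moreover have "(\<lambda>n. d + 1 / real (Suc n)) \<longlonglongrightarrow> d + 0" by (intro tendsto_intros inv0)
  ultimately have "J v \<le> d + 0" using X by (intro LIMSEQ_le) (auto intro: less_imp_le)
  then have min: "J v \<le> J x" for x using dJ[of x] by simp
  have "f h = inner v h" for h
  proof -
    define c N where "c = inner v h - f h" and "N = 1 + (norm h)\<^sup>2"
    have N: "N > 0" unfolding N_def by (simp add: add_pos_nonneg)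
    \<comment> \<open>the minimizer of \<open>a \<mapsto> a\<^sup>2 N + 2 a c\<close>, which dominates the increment \<open>J (v + a h) - J v\<close>\<close>
    define a where "a = - c / N"
    have Na: "N * a = - c" using N by (simp add: a_def)
    have "J (v + a *\<^sub>R h) - J v = a\<^sup>2 * (norm h)\<^sup>2 + 2 * a * c"
      unfolding J_def power2_norm_eq_inner c_def
      by (simp add: f.scaleR f.add inner_add_left inner_add_right power2_eq_square
          inner_commute[of h v] algebra_simps)
    then have "0 \<le> a\<^sup>2 * (norm h)\<^sup>2 + 2 * a * c" using min[of "v + a *\<^sub>R h"] by linarith
    then have "0 \<le> N\<^sup>2 * (a\<^sup>2 * (norm h)\<^sup>2 + 2 * a * c)" by simp
    also have "\<dots> = (N * a)\<^sup>2 * (norm h)\<^sup>2 + 2 * (N * a) * (N * c)"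
      by (simp add: power2_eq_square algebra_simps)
    also have "\<dots> = - (c\<^sup>2 * (2 + (norm h)\<^sup>2))"
      unfolding Na by (simp add: N_def power2_eq_square algebra_simps)
    finally have "c\<^sup>2 * (2 + (norm h)\<^sup>2) \<le> 0" by simp
    moreover have "2 + (norm h)\<^sup>2 > 0" by (simp add: add_pos_nonneg)
    ultimately have "c = 0" by (simp add: mult_le_0_iff)
    then show ?thesis by (simp add: c_def)
  qed
  then show ?thesis by blast
qed

text \<open>
  For small \<open>s > 0\<close> the map \<open>x \<mapsto> x - s (T x - y)\<close> is a contraction, and its fixed point solves
  \<open>T x = y\<close>. The lemma locates the spectrum of a positive operator: it applies to \<open>A - t\<close> for
  \<open>t < 0\<close> and to \<open>t - A\<close> for \<open>t > \<parallel>A\<parallel>\<close>.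
\<close>

lemma coercive_invertible:
  fixes T :: "'a::{real_inner,complete_space} \<Rightarrow>\<^sub>L 'a"
  assumes c: "c > 0" and co: "\<And>x. c * (norm x)\<^sup>2 \<le> inner (T x) x"
  shows "\<exists>B :: 'a \<Rightarrow>\<^sub>L 'a. (\<forall>x. B (T x) = x) \<and> (\<forall>x. T (B x) = x)"
proof -
  define K where "K = norm T + c"
  have K: "K > 0" "c \<le> K" "norm T \<le> K" using c by (auto simp: K_def intro: add_nonneg_pos)
  \<comment> \<open>the step size that minimizes the bound \<open>1 - 2 s c + s\<^sup>2 K\<^sup>2\<close> on the squared contraction factor\<close>
  define s where "s = c / K\<^sup>2"
  have s: "s > 0" using c K by (simp add: s_def)
  define q where "q = sqrt (1 - c\<^sup>2 / K\<^sup>2)"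
  have "c\<^sup>2 \<le> K\<^sup>2" using c K by (simp add: power_mono)
  then have q2: "q\<^sup>2 = 1 - c\<^sup>2 / K\<^sup>2" using K by (simp add: q_def divide_le_eq)
  have q: "0 \<le> q" "q < 1" using \<open>c\<^sup>2 \<le> K\<^sup>2\<close> c K by (auto simp: q_def divide_le_eq)
  have contr: "norm (w - s *\<^sub>R T w) \<le> q * norm w" for w
  proof -
    have "(norm (w - s *\<^sub>R T w))\<^sup>2 = (norm w)\<^sup>2 - 2 * s * inner (T w) w + s\<^sup>2 * (norm (T w))\<^sup>2"
      unfolding power2_norm_eq_inner
      by (simp add: inner_diff_left inner_diff_right inner_commute power2_eq_square algebra_simps)
    also have "\<dots> \<le> (norm w)\<^sup>2 - 2 * s * (c * (norm w)\<^sup>2) + s\<^sup>2 * (K\<^sup>2 * (norm w)\<^sup>2)"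
    proof -
      have "norm (T w) \<le> K * norm w"
        using norm_blinfun[of T w] K by (meson order_trans mult_right_mono norm_ge_zero)
      then have "(norm (T w))\<^sup>2 \<le> K\<^sup>2 * (norm w)\<^sup>2"
        using power_mono[of "norm (T w)" "K * norm w" 2] by (simp add: power_mult_distrib)
      then have "s\<^sup>2 * (norm (T w))\<^sup>2 \<le> s\<^sup>2 * (K\<^sup>2 * (norm w)\<^sup>2)" by (simp add: mult_left_mono)
      moreover have "2 * s * (c * (norm w)\<^sup>2) \<le> 2 * s * inner (T w) w"
        using co[of w] s by simp
      ultimately show ?thesis by linarith
    qed
    also have "\<dots> = q\<^sup>2 * (norm w)\<^sup>2"
      unfolding q2 s_def using K by (simp add: field_simps power2_eq_square)
    finally show ?thesis using q by (simp add: power_mult_distrib[symmetric] power2_le_iff_abs_le)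
  qed
  have lip: "dist (x - s *\<^sub>R (T x - y)) (z - s *\<^sub>R (T z - y)) \<le> q * dist x z" for x z y
  proof -
    have eq: "(x - s *\<^sub>R (T x - y)) - (z - s *\<^sub>R (T z - y)) = (x - z) - s *\<^sub>R T (x - z)"
      by (simp add: blinfun.diff_right scaleR_diff_right)
    show ?thesis unfolding dist_norm eq by (rule contr)
  qed
  have "\<exists>x. T x = y" for y
  proof -
    have "\<exists>!x. x - s *\<^sub>R (T x - y) = x" by (rule banach_fix_type[OF q]) (use lip in blast)
    then show ?thesis using s by auto
  qed
  then obtain b where b: "\<And>y. T (b y) = y" by metis
  have low: "c * norm x \<le> norm (T x)" for x
  proof (cases "x = 0")
    case False
    have "c * norm x * norm x \<le> norm (T x) * norm x"
      using co[of x] norm_cauchy_schwarz[of "T x" x] by (simp add: power2_eq_square algebra_simps)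
    then show ?thesis using False by simp
  qed simp
  have inj: "x = y" if "T x = T y" for x y
    using low[of "x - y"] that c by (simp add: blinfun.diff_right mult_le_0_iff)
  have "bounded_linear b"
  proof (rule bounded_linear_intro[of _ "1/c"])
    show "b (x + y) = b x + b y" for x y by (rule inj) (simp add: b blinfun.add_right)
    show "b (r *\<^sub>R x) = r *\<^sub>R b x" for r x by (rule inj) (simp add: b blinfun.scaleR_right)
    show "norm (b x) \<le> norm x * (1/c)" for x using low[of "b x"] c by (simp add: b field_simps)
  qed
  moreover have "b (T x) = x" for x by (rule inj) (rule b)
  ultimately show ?thesis
    by (intro exI[of _ "Blinfun b"]) (simp add: bounded_linear_Blinfun_apply b)
qed

section \<open>Polynomials in a self-adjoint operator\<close>

lemma op_power_0 [simp]: "op_power A 0 = id_blinfun" by (simp add: op_power_def)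
lemma op_power_Suc [simp]: "op_power A (Suc n) = A o\<^sub>L op_power A n" by (simp add: op_power_def)

lemma op_poly_altdef:
  assumes "degree p \<le> n"
  shows "op_poly p A = (\<Sum>i\<le>n. coeff p i *\<^sub>R op_power A i)"
  unfolding op_poly_def using assms
  by (intro sum.mono_neutral_left) (auto simp: coeff_eq_0)

lemma op_poly_0 [simp]: "op_poly 0 A = 0" by (simp add: op_poly_def)

text \<open>
  With Horner's rule the algebra homomorphism properties of \<open>p \<mapsto> p(A)\<close> follow by induction on
  polynomials.
\<close>

lemma op_poly_pCons: "op_poly (pCons a p) A = a *\<^sub>R id_blinfun + (A o\<^sub>L op_poly p A)"
proof -
  have "op_poly (pCons a p) A = (\<Sum>i\<le>Suc (degree p). coeff (pCons a p) i *\<^sub>R op_power A i)"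
    by (rule op_poly_altdef) (simp add: degree_pCons_eq_if)
  also have "\<dots> = a *\<^sub>R id_blinfun + (A o\<^sub>L op_poly p A)"
    by (subst sum.atMost_Suc_shift, rule blinfun_eqI)
       (simp add: op_poly_def blinfun.add_left blinfun.scaleR_left blinfun.sum_left
          blinfun.sum_right blinfun.scaleR_right)
  finally show ?thesis .
qed

lemma op_poly_add: "op_poly (p + q) A = op_poly p A + op_poly q A"
  using op_poly_altdef[of p "max (degree p) (degree q)" A] op_poly_altdef[of q "max (degree p) (degree q)" A]
    op_poly_altdef[of "p + q" "max (degree p) (degree q)" A]
  by (simp add: degree_add_le scaleR_add_left sum.distrib)

lemma op_poly_smult: "op_poly (smult c p) A = c *\<^sub>R op_poly p A"
  using op_poly_altdef[of p "degree p" A] op_poly_altdef[of "smult c p" "degree p" A]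
  by (simp add: scaleR_sum_right)

lemma op_poly_diff: "op_poly (p - q) A = op_poly p A - op_poly q A"
  using op_poly_add[of p "- q" A] op_poly_smult[of "-1" q A] by simp

lemma op_poly_mult: "op_poly (p * q) A = op_poly p A o\<^sub>L op_poly q A"
proof (induction p)
  case (pCons a p)
  then show ?case
    by (auto simp: op_poly_pCons op_poly_add op_poly_smult blinfun.add_left blinfun.scaleR_left
        intro!: blinfun_eqI)
qed simp

lemma op_poly_pcompose: "op_poly (p \<circ>\<^sub>p [:e, 1:]) A = op_poly p (A + e *\<^sub>R id_blinfun)"
proof (induction p)
  case (pCons a p)
  then show ?case
    by (auto simp: op_poly_pCons op_poly_add op_poly_mult op_poly_smult pcompose_pCons blinfun.add_left
        blinfun.scaleR_left intro!: blinfun_eqI)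
qed simp

text \<open>
  The functional calculus is defined through the real points of the spectrum. At such
  a point the resolvent condition involves real scalars only.
\<close>

abbreviation real_spectrum :: "('a::complex_hilbert \<Rightarrow>\<^sub>L 'a) \<Rightarrow> real set"
  where "real_spectrum A \<equiv> {t. complex_of_real t \<in> op_spectrum A}"

lemma real_spectrum_iff:
  "complex_of_real t \<in> op_spectrum A \<longleftrightarrow>
    \<not> (\<exists>B. (\<forall>x. blinfun_apply B (A x - t *\<^sub>R x) = x) \<and> (\<forall>x. A (B x) - t *\<^sub>R B x = x))"
  by (simp add: op_spectrum_def scaleR_scaleC)

lemma real_spectrum_shift: "t + e \<in> real_spectrum (A + e *\<^sub>R id_blinfun) \<longleftrightarrow> t \<in> real_spectrum A"
  unfolding mem_Collect_eq real_spectrum_iff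
  by (simp add: blinfun.add_left blinfun.scaleR_left scaleR_add_left)

text \<open>
  A real \<open>t\<close> for which \<open>A - t\<close> fails this condition is an approximate eigenvalue of \<open>A\<close>.
\<close>

definition bounded_below :: "('a::real_normed_vector \<Rightarrow> 'b::real_normed_vector) \<Rightarrow> bool"
  where "bounded_below f \<longleftrightarrow> (\<exists>c>0. \<forall>x. c * norm x \<le> norm (f x))"

lemma bounded_below_compose:
  assumes "bounded_below f" "bounded_below g"
  shows "bounded_below (\<lambda>x. f (g x))"
proof -
  obtain c d where cd: "c > 0" "d > 0" "\<And>x. c * norm x \<le> norm (f x)" "\<And>x. d * norm x \<le> norm (g x)"
    using assms unfolding bounded_below_def by auto
  have "c * d * norm x \<le> norm (f (g x))" for x
    using order_trans[OF mult_left_mono[OF cd(4)[of x], of c] cd(3)[of "g x"]] cd(1) by (simp add: mult.assoc)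
  then show ?thesis unfolding bounded_below_def using cd by (intro exI[of _ "c * d"]) auto
qed

lemma bounded_below_outside_spectrum:
  assumes "t \<notin> real_spectrum A"
  shows "bounded_below (\<lambda>x. A x - t *\<^sub>R x)"
proof -
  obtain B :: "'a \<Rightarrow>\<^sub>L 'a" where B: "\<And>x. B (A x - t *\<^sub>R x) = x"
    using assms by (auto simp: real_spectrum_iff)
  have "1 / (norm B + 1) * norm x \<le> norm (A x - t *\<^sub>R x)" for x
  proof -
    have "norm x \<le> norm B * norm (A x - t *\<^sub>R x)" by (metis B norm_blinfun)
    also have "\<dots> \<le> (norm B + 1) * norm (A x - t *\<^sub>R x)" by (simp add: mult_right_mono)
    finally show ?thesis by (simp add: divide_le_eq mult.commute add_nonneg_pos)
  qed
  then show ?thesis unfolding bounded_below_def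
    by (intro exI[of _ "1 / (norm B + 1)"]) (auto intro: add_nonneg_pos)
qed

text \<open>
  A complex root \<open>a + i b\<close> is either real or contributes the quadratic factor
  \<open>(X - a)\<^sup>2 + b\<^sup>2\<close>. The division of \<open>p\<close> by this factor leaves a remainder of degree at most one that
  vanishes at a non-real point.
\<close>

lemma real_poly_complex_root_factor:
  fixes p :: "real poly"
  assumes "degree p > 0"
  obtains (linear) a where "poly p a = 0" "[:-a, 1:] dvd p"
    | (quadratic) a b where "b \<noteq> 0" "[:a\<^sup>2 + b\<^sup>2, - 2 * a, 1:] dvd p"
proof -
  define E where "E q z = poly (map_poly complex_of_real q) z" for q z
  have E_pCons: "E (pCons a q) z = of_real a + z * E q z" for a q z
    by (simp add: E_def map_poly_pCons)
  have E_0: "E 0 z = 0" for z by (simp add: E_def)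
  have E_add: "E (q + r) z = E q z + E r z" for q r z
    by (induction q r rule: poly_induct2) (auto simp: E_pCons E_0 algebra_simps)
  have E_smult: "E (smult c q) z = of_real c * E q z" for c q z
    by (induction q) (auto simp: E_pCons E_0 algebra_simps)
  have E_mult: "E (q * r) z = E q z * E r z" for q r z
    by (induction q) (auto simp: E_pCons E_0 E_add E_smult algebra_simps)
  have E_real: "E q (of_real x) = of_real (poly q x)" for q x
    by (induction q) (auto simp: E_pCons E_0)
  have "degree (map_poly complex_of_real p) = degree p" by (rule degree_map_poly) simp
  then have "\<not> constant (poly (map_poly complex_of_real p))"
    using assms by (simp add: constant_degree)
  then obtain z where z: "E p z = 0"
    using fundamental_theorem_of_algebra unfolding E_def by blast
  show thesis
  proof (cases "Im z = 0")
    case True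
    then have "z = of_real (Re z)" by (simp add: complex_eq_iff)
    then have "poly p (Re z) = 0" using z E_real[of p "Re z"] by simp
    then show thesis using linear by (simp add: poly_eq_0_iff_dvd)
  next
    case False
    define Q where "Q = [:(Re z)\<^sup>2 + (Im z)\<^sup>2, - 2 * Re z, 1:]"
    have Q0: "E Q z = 0"
      by (simp add: Q_def E_pCons E_0 complex_eq_iff power2_eq_square algebra_simps)
    define r where "r = p mod Q"
    have "degree Q = 2" by (simp add: Q_def)
    have r: "E r z = 0"
    proof -
      have "E p z = E (Q * (p div Q)) z + E r z"
        unfolding r_def E_add[symmetric] by simp
      then show ?thesis using z Q0 by (simp add: E_mult)
    qed
    have "r = 0 \<or> degree r < 2"
      using degree_mod_less[of Q p] \<open>degree Q = 2\<close> by (auto simp: r_def Q_def)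
    then have "degree r \<le> 1" by auto
    then have r01: "r = [:coeff r 0, coeff r 1:]"
      by (intro poly_eqI) (auto simp: coeff_pCons coeff_eq_0 split: nat.split)
    define r0 r1 where "r0 = coeff r 0" and "r1 = coeff r 1"
    note r01 = r01[folded r0_def r1_def]
    then have "r1 * Im z = 0" "r0 + r1 * Re z = 0"
      using r by (auto simp: E_pCons E_0 complex_eq_iff mult.commute)
    then have "r = 0" using False r01 by simp
    then have "Q dvd p" by (simp add: r_def mod_eq_0_iff_dvd)
    then show thesis using quadratic False unfolding Q_def by blast
  qed
qed

locale selfadjoint_op =
  fixes A :: "'a::complex_hilbert \<Rightarrow>\<^sub>L 'a"
  assumes symmetric: "inner (A x) y = inner x (A y)"
begin

lemma op_poly_symmetric: "inner (op_poly p A x) y = inner x (op_poly p A y)"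
proof (induction p arbitrary: x y)
  case (pCons a p)
  have "op_poly p A (A y) = A (op_poly p A y)" for y
  proof -
    have X: "op_poly [:0, 1:] A = A" by (auto simp: op_poly_pCons intro!: blinfun_eqI)
    show ?thesis
      using op_poly_mult[of p "[:0,1:]" A] op_poly_mult[of "[:0,1:]" p A]
      unfolding X mult.commute[of "[:0, 1:]" p] by (metis blinfun_apply_blinfun_compose)
  qed
  with pCons show ?case
    by (simp add: op_poly_pCons blinfun.add_left blinfun.scaleR_left inner_add_left inner_add_right symmetric)
qed simp

text \<open>
  One half of the spectral mapping theorem. The operator of a real linear factor \<open>X - t\<close> is bounded
  below because \<open>t\<close> is outside the spectrum; the operator of a quadratic factor \<open>(X - a)\<^sup>2 + b\<^sup>2\<close> is
  bounded below by \<open>b\<^sup>2\<close> because \<open>(A - a)\<^sup>2\<close> is positive.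
\<close>

lemma op_poly_bounded_below:
  assumes "p \<noteq> 0" and "\<And>t. t \<in> real_spectrum A \<Longrightarrow> poly p t \<noteq> 0"
  shows "bounded_below (op_poly p A)"
  using assms
proof (induction "degree p" arbitrary: p rule: less_induct)
  case less
  show ?case
  proof (cases "degree p = 0")
    case True
    then obtain a where a: "p = [:a:]" by (metis degree_eq_zeroE)
    then show ?thesis using less.prems unfolding bounded_below_def
      by (intro exI[of _ "\<bar>a\<bar>"]) (auto simp: op_poly_pCons blinfun.scaleR_left)
  next
    case False
    then have "degree p > 0" by simp
    then obtain q r where p: "p = q * r" and dq: "degree q > 0" and q: "bounded_below (op_poly q A)"
    proof (cases rule: real_poly_complex_root_factor)
      case (linear a)
      then obtain r where "p = [:-a, 1:] * r" by (auto elim: dvdE)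
      moreover have "blinfun_apply (op_poly [:-a, 1:] A) = (\<lambda>x. A x - a *\<^sub>R x)"
        by (rule ext) (simp add: op_poly_pCons blinfun.diff_left blinfun.scaleR_left)
      then have "bounded_below (op_poly [:-a, 1:] A)"
        using bounded_below_outside_spectrum[of a A] less.prems(2) linear by auto
      ultimately show thesis using that[of "[:-a, 1:]" r] by simp
    next
      case (quadratic a b)
      let ?Q = "[:a\<^sup>2 + b\<^sup>2, - 2 * a, 1:]"
      obtain r where r: "p = ?Q * r" using quadratic(2) by (auto elim: dvdE)
      have "b\<^sup>2 * norm x \<le> norm (op_poly ?Q A x)" for x
      proof (cases "x = 0")
        case False
        have "inner (op_poly ?Q A x) x = (norm (A x - a *\<^sub>R x))\<^sup>2 + b\<^sup>2 * (norm x)\<^sup>2"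
          unfolding power2_norm_eq_inner
          by (simp add: op_poly_pCons blinfun.add_left blinfun.diff_left blinfun.diff_right blinfun.scaleR_left blinfun.add_right
              blinfun.scaleR_right inner_add_left inner_diff_left inner_diff_right inner_commute
              symmetric power2_eq_square algebra_simps)
        then have "b\<^sup>2 * norm x * norm x \<le> inner (op_poly ?Q A x) x"
          by (simp add: power2_eq_square)
        also have "\<dots> \<le> norm (op_poly ?Q A x) * norm x" by (rule norm_cauchy_schwarz)
        finally show ?thesis using False by simp
      qed simp
      then have "bounded_below (op_poly ?Q A)"
        unfolding bounded_below_def using quadratic(1) by (intro exI[of _ "b\<^sup>2"]) auto
      then show thesis using that[OF r] by simp
    qed
    have "r \<noteq> 0" "degree r < degree p" 
      using p dq less.prems(1) by (auto simp: degree_mult_eq)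
    moreover have "poly r t \<noteq> 0" if "t \<in> real_spectrum A" for t
      using less.prems(2)[OF that] p by auto
    ultimately have "bounded_below (op_poly r A)" using less.hyps by blast
    moreover have "blinfun_apply (op_poly p A) = (\<lambda>x. op_poly q A (op_poly r A x))"
      by (rule ext) (simp add: p op_poly_mult)
    ultimately show ?thesis using bounded_below_compose[OF q] by simp
  qed
qed

text \<open>
  The number \<open>m\<close> is the infimum of the form of \<open>p(A)\<close> over the unit sphere. The operator
  \<open>S = p(A) - m\<close> is positive, so \<open>\<parallel>S x\<parallel>\<^sup>2\<close> is at most a constant times \<open>\<langle>S x, x\<rangle>\<close>, which is
  arbitrarily small for suitable unit vectors.
\<close>

lemma form_infimum_not_bounded_below:
  assumes nz: "\<exists>x::'a. x \<noteq> 0"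
  shows "\<exists>m. (\<forall>x. m * (norm x)\<^sup>2 \<le> inner (op_poly p A x) x) \<and> \<not> bounded_below (op_poly (p - [:m:]) A)"
proof -
  define T where "T = op_poly p A"
  define V where "V = (\<lambda>x. inner (T x) x) ` {x. norm x = 1}"
  obtain x0 :: 'a where x0: "norm x0 = 1" using nz by (metis norm_sgn)
  have bdd: "bdd_below V"
  proof (rule bdd_belowI)
    fix v assume "v \<in> V"
    then obtain x where x: "norm x = 1" "v = inner (T x) x" by (auto simp: V_def)
    then have "\<bar>v\<bar> \<le> norm T" using Cauchy_Schwarz_ineq2[of "T x" x] norm_blinfun[of T x] by simp
    then show "- norm T \<le> v" by simp
  qed
  have ne: "V \<noteq> {}" using x0 by (auto simp: V_def)
  define m where "m = Inf V"
  have m: "m * (norm x)\<^sup>2 \<le> inner (T x) x" for x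
  proof (cases "x = 0")
    case False
    have "m \<le> inner (T (sgn x)) (sgn x)"
      unfolding m_def using False by (intro cInf_lower bdd) (auto simp: V_def norm_sgn)
    then show ?thesis using False
      by (simp add: sgn_div_norm blinfun.scaleR_right field_simps power2_eq_square)
  qed (simp add: blinfun.zero_right)
  define S where "S = op_poly (p - [:m:]) A"
  have S: "S x = T x - m *\<^sub>R x" for x
    by (simp add: S_def T_def op_poly_diff op_poly_pCons blinfun.diff_left blinfun.scaleR_left)
  have Ssym: "inner (S x) y = inner x (S y)" for x y unfolding S_def by (rule op_poly_symmetric)
  have Spos: "inner (S x) x \<ge> 0" for x
    using m[of x] by (simp add: S inner_diff_left power2_norm_eq_inner)
  have "\<not> bounded_below S"
  proof
    assume "bounded_below S"
    then obtain c where c: "c > 0" "\<And>x. c * norm x \<le> norm (S x)" unfolding bounded_below_def by auto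
    define k where "k = c\<^sup>2 / (norm S + 1)"
    have N: "norm S + 1 > 0" by (simp add: add_nonneg_pos)
    have k: "k > 0" using c N by (simp add: k_def)
    have "\<exists>v\<in>V. v < m + k" using cInf_lessD[OF ne, of "m + k"] k by (auto simp: m_def)
    then obtain x where x: "norm x = 1" "inner (T x) x < m + k" by (auto simp: V_def)
    define y where "y = S x"
    define q where "q = inner y x"
    have q: "q < k" "q \<ge> 0" using x Spos[of x] by (auto simp: q_def y_def S inner_diff_left power2_norm_eq_inner[symmetric])
    have Sy: "inner (S y) y \<le> norm S * (norm y)\<^sup>2"
      using norm_cauchy_schwarz[of "S y" y] mult_right_mono[OF norm_blinfun[of S y], of "norm y"]
      by (simp add: power2_eq_square mult.assoc)
    have "(norm y)\<^sup>2 \<le> (norm S + 1) * q"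
    proof -
      define s where "s = 1 / (norm S + 1)"
      have s: "s > 0" "(norm S + 1) * s = 1" using N by (auto simp: s_def)
      \<comment> \<open>positivity at \<open>x - s S x\<close> yields \<open>s \<parallel>S x\<parallel>\<^sup>2 \<le> \<langle>S x, x\<rangle>\<close>, as in the proof of the Cauchy--Schwarz inequality\<close>
      have "0 \<le> inner (S (x - s *\<^sub>R y)) (x - s *\<^sub>R y)" by (rule Spos)
      also have "\<dots> = q - 2 * s * (norm y)\<^sup>2 + s\<^sup>2 * inner (S y) y"
        unfolding q_def power2_norm_eq_inner using Ssym[of x y]
        by (simp add: y_def blinfun.diff_right blinfun.scaleR_right inner_diff_left inner_diff_right
            inner_commute Ssym power2_eq_square algebra_simps)
      also have "\<dots> \<le> q - 2 * s * (norm y)\<^sup>2 + s\<^sup>2 * ((norm S + 1) * (norm y)\<^sup>2)"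
        using Sy by (intro add_left_mono mult_left_mono) (auto simp: algebra_simps intro: add_increasing)
      also have "\<dots> = q - 2 * s * (norm y)\<^sup>2 + s * (norm y)\<^sup>2 * ((norm S + 1) * s)"
        by (simp add: power2_eq_square algebra_simps)
      also have "\<dots> = q - s * (norm y)\<^sup>2" unfolding s(2) by simp
      finally have "s * (norm y)\<^sup>2 \<le> q" by simp
      then show ?thesis using N by (simp add: s_def divide_le_eq mult.commute)
    qed
    also have "\<dots> < (norm S + 1) * k" using q N by simp
    also have "\<dots> = c\<^sup>2" using N by (simp add: k_def)
    finally have "norm y < c" using c by (simp add: power_less_imp_less_base)
    then show False using c(2)[of x] x by (simp add: y_def)
  qed
  then show ?thesis using m unfolding S_def T_def by blast
qed

lemma real_spectrum_nonempty:
  assumes nz: "\<exists>x::'a. x \<noteq> 0"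
  shows "real_spectrum A \<noteq> {}"
proof -
  obtain m where m: "\<not> bounded_below (op_poly ([:0, 1:] - [:m:]) A)"
    using form_infimum_not_bounded_below[OF nz, of "[:0,1:]"] by blast
  have "[:0, 1:] - [:m:] = [:-m, 1:]" by simp
  then show ?thesis using m op_poly_bounded_below[of "[:-m, 1:]"] by auto
qed

text \<open>
  The infimum \<open>m\<close> of the form is a value of \<open>p\<close> on the spectrum, since otherwise \<open>p(A) - m\<close> would be
  bounded below. For constant \<open>p\<close> this argument needs some point of the spectrum.
\<close>

lemma op_poly_nonneg:
  assumes p: "\<And>t. t \<in> real_spectrum A \<Longrightarrow> poly p t \<ge> 0"
  shows "inner (op_poly p A x) x \<ge> 0"
proof (cases "\<exists>x::'a. x \<noteq> 0")
  case True
  then obtain m where m: "\<And>x. m * (norm x)\<^sup>2 \<le> inner (op_poly p A x) x"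
    and nb: "\<not> bounded_below (op_poly (p - [:m:]) A)"
    using form_infimum_not_bounded_below by blast
  have "m \<ge> 0"
  proof (cases "p = [:m:]")
    case True
    then show ?thesis using real_spectrum_nonempty[OF \<open>\<exists>x::'a. x \<noteq> 0\<close>] p by auto
  next
    case False
    then obtain t where "t \<in> real_spectrum A" "poly (p - [:m:]) t = 0"
      using op_poly_bounded_below[of "p - [:m:]"] nb by auto
    then show ?thesis using p[of t] by auto
  qed
  then have "0 \<le> m * (norm x)\<^sup>2" by simp
  then show ?thesis using m[of x] by linarith
next
  case False
  then have "x = 0" by blast
  then show ?thesis by simp
qed

text \<open>
  Positivity of \<open>c\<^sup>2 - p\<^sup>2\<close> on the spectrum gives \<open>\<parallel>p(A) x\<parallel>\<^sup>2 \<le> c\<^sup>2 \<parallel>x\<parallel>\<^sup>2\<close>.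
\<close>

lemma norm_op_poly_le:
  assumes c: "0 \<le> c" and p: "\<And>t. t \<in> real_spectrum A \<Longrightarrow> \<bar>poly p t\<bar> \<le> c"
  shows "norm (op_poly p A) \<le> c"
proof (rule norm_blinfun_bound[OF c])
  fix x
  have "inner (op_poly ([:c\<^sup>2:] - p * p) A x) x \<ge> 0"
  proof (rule op_poly_nonneg)
    fix t assume "t \<in> real_spectrum A"
    then show "0 \<le> poly ([:c\<^sup>2:] - p * p) t"
      using power_mono[OF p, of t 2] by (simp add: power2_eq_square)
  qed
  then have "(norm (op_poly p A x))\<^sup>2 \<le> (c * norm x)\<^sup>2"
    by (simp add: op_poly_diff op_poly_mult op_poly_pCons blinfun.diff_left blinfun.scaleR_left
        inner_diff_left op_poly_symmetric power_mult_distrib power2_norm_eq_inner)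
  then show "norm (op_poly p A x) \<le> c * norm x" using c by (simp add: power2_le_iff_abs_le)
qed

end

section \<open>Continuous functional calculus of a positive operator\<close>

lemma weierstrass_poly:
  fixes f :: "real \<Rightarrow> real"
  assumes "continuous_on {a..b} f"
  obtains p where "uniform_limit {a..b} (\<lambda>n. poly (p n)) f sequentially"
proof -
  have "\<exists>p. \<forall>x\<in>{a..b}. \<bar>f x - poly p x\<bar> < 1 / real (Suc n)" for n
  proof -
    obtain g where g: "real_polynomial_function g" "\<And>x. x \<in> {a..b} \<Longrightarrow> \<bar>f x - g x\<bar> < 1 / real (Suc n)"
      using Stone_Weierstrass_real_polynomial_function[OF compact_Icc assms, of "1 / real (Suc n)"] by auto
    from g(1) obtain c k where "g = (\<lambda>x. \<Sum>i\<le>k. c i * x ^ i)"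
      unfolding real_polynomial_function_iff_sum by blast
    then have "g = poly (\<Sum>i\<le>k. monom (c i) i)" by (auto simp: poly_sum poly_monom)
    with g(2) show ?thesis by blast
  qed
  then obtain p where p: "\<And>n x. x \<in> {a..b} \<Longrightarrow> \<bar>f x - poly (p n) x\<bar> < 1 / real (Suc n)" by metis
  have "uniform_limit {a..b} (\<lambda>n. poly (p n)) f sequentially"
  proof (rule uniform_limitI)
    fix e :: real assume "e > 0"
    then have "\<forall>\<^sub>F n in sequentially. 1 / real (Suc n) < e"
      by (intro order_tendstoD(2)[OF LIMSEQ_Suc[OF lim_1_over_n]]) auto
    then show "\<forall>\<^sub>F n in sequentially. \<forall>x\<in>{a..b}. dist (poly (p n) x) (f x) < e"
    proof eventually_elim
      case (elim n)
      then show ?case using p[of _ n] by (force simp: dist_real_def abs_minus_commute)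
    qed
  qed
  then show thesis by (rule that)
qed

locale positive_op = selfadjoint_op +
  assumes nonneg: "0 \<le> inner (A x) x"
begin

lemma real_spectrum_bounds: "real_spectrum A \<subseteq> {0..norm A}"
proof
  fix t assume t: "t \<in> real_spectrum A"
  have "\<not> t < 0"
  proof
    assume "t < 0"
    define T where "T = A - t *\<^sub>R id_blinfun"
    have "- t * (norm x)\<^sup>2 \<le> inner (T x) x" for x
      using nonneg[of x]
      by (simp add: T_def blinfun.diff_left blinfun.scaleR_left inner_diff_left power2_norm_eq_inner)
    from coercive_invertible[OF _ this] \<open>t < 0\<close>
    obtain B :: "'a \<Rightarrow>\<^sub>L 'a" where "\<forall>x. B (T x) = x" "\<forall>x. T (B x) = x" by auto
    then show False using t
      by (auto simp: real_spectrum_iff T_def blinfun.diff_left blinfun.scaleR_left)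
  qed
  moreover have "\<not> t > norm A"
  proof
    assume tA: "t > norm A"
    define T where "T = t *\<^sub>R id_blinfun - A"
    have "(t - norm A) * (norm x)\<^sup>2 \<le> inner (T x) x" for x
      using norm_cauchy_schwarz[of "A x" x] mult_right_mono[OF norm_blinfun[of A x], of "norm x"]
      by (simp add: T_def blinfun.diff_left blinfun.scaleR_left inner_diff_left
          power2_norm_eq_inner[symmetric] left_diff_distrib power2_eq_square mult.assoc)
    from coercive_invertible[OF _ this] tA
    obtain B :: "'a \<Rightarrow>\<^sub>L 'a" where B: "\<And>x. B (T x) = x" "\<And>x. T (B x) = x" by auto
    have "(- B) (A x - t *\<^sub>R x) = x" for x
      using B(1)[of x] by (simp add: T_def blinfun.diff_left blinfun.scaleR_left blinfun.minus_left
          blinfun.diff_right)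
    moreover have "A ((- B) x) - t *\<^sub>R (- B) x = x" for x
      using B(2)[of x] by (simp add: T_def blinfun.diff_left blinfun.scaleR_left blinfun.minus_left
          blinfun.minus_right)
    ultimately show False using t unfolding mem_Collect_eq real_spectrum_iff by blast
  qed
  ultimately show "t \<in> {0..norm A}" by auto
qed

lemma op_poly_diff_tendsto_0:
  assumes "uniform_limit (real_spectrum A) (\<lambda>n. poly (p n)) f F"
    and "uniform_limit (real_spectrum A) (\<lambda>n. poly (q n)) f F"
  shows "((\<lambda>n. op_poly (p n) A - op_poly (q n) A) \<longlongrightarrow> 0) F"
proof (rule tendstoI)
  fix e :: real assume e: "e > 0"
  have "\<forall>\<^sub>F n in F. \<forall>t\<in>real_spectrum A. dist (poly (p n) t) (f t) < e / 4"
    "\<forall>\<^sub>F n in F. \<forall>t\<in>real_spectrum A. dist (poly (q n) t) (f t) < e / 4"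
    using uniform_limitD[OF assms(1), of "e / 4"] uniform_limitD[OF assms(2), of "e / 4"] e by simp_all
  then show "\<forall>\<^sub>F n in F. dist (op_poly (p n) A - op_poly (q n) A) 0 < e"
  proof eventually_elim
    case (elim n)
    have "norm (op_poly (p n - q n) A) \<le> e / 2"
    proof (rule norm_op_poly_le)
      fix t assume "t \<in> real_spectrum A"
      then have "dist (poly (p n) t) (f t) < e / 4" "dist (poly (q n) t) (f t) < e / 4"
        using elim by auto
      then show "\<bar>poly (p n - q n) t\<bar> \<le> e / 2" unfolding dist_real_def poly_diff by argo
    qed (use e in simp)
    then show ?case using e by (simp add: op_poly_diff)
  qed
qed

text \<open>
  The description of \<open>f(A)\<close> in the definition does determine an operator: an approximating
  sequence exists by the Weierstrass theorem, \<open>norm_op_poly_le\<close> makes its values at \<open>A\<close> a Cauchy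
  sequence, and any two approximating sequences have the same limit.
\<close>

lemma op_fun_limit:
  assumes f: "continuous_on {0..norm A} f"
    and p: "uniform_limit (real_spectrum A) (\<lambda>n. poly (p n)) f sequentially"
  shows "(\<lambda>n. op_poly (p n) A) \<longlonglongrightarrow> op_fun f A"
proof -
  obtain q where "uniform_limit {0..norm A} (\<lambda>n. poly (q n)) f sequentially"
    using weierstrass_poly[OF f] .
  then have q: "uniform_limit (real_spectrum A) (\<lambda>n. poly (q n)) f sequentially"
    by (rule uniform_limit_on_subset) (rule real_spectrum_bounds)
  have "Cauchy (\<lambda>n. op_poly (q n) A)"
  proof (rule metric_CauchyI)
    fix e :: real assume e: "e > 0"
    have "\<forall>\<^sub>F n in sequentially. \<forall>t\<in>real_spectrum A. dist (poly (q n) t) (f t) < e / 4"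
      using e by (intro uniform_limitD[OF q]) simp
    then obtain N where N: "\<And>n t. n \<ge> N \<Longrightarrow> t \<in> real_spectrum A \<Longrightarrow> dist (poly (q n) t) (f t) < e / 4"
      unfolding eventually_sequentially by blast
    have "dist (op_poly (q m) A) (op_poly (q n) A) < e" if "m \<ge> N" "n \<ge> N" for m n
    proof -
      have "norm (op_poly (q m - q n) A) \<le> e / 2"
      proof (rule norm_op_poly_le)
        fix t assume "t \<in> real_spectrum A"
        from N[OF that(1) this] N[OF that(2) this] show "\<bar>poly (q m - q n) t\<bar> \<le> e / 2"
          unfolding dist_real_def poly_diff by argo
      qed (use e in simp)
      then show ?thesis using e by (simp add: op_poly_diff dist_norm)
    qed
    then show "\<exists>M. \<forall>m\<ge>M. \<forall>n\<ge>M. dist (op_poly (q m) A) (op_poly (q n) A) < e" by blast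
  qed
  then obtain B where B: "(\<lambda>n. op_poly (q n) A) \<longlonglongrightarrow> B"
    by (auto simp: Cauchy_convergent_iff convergent_def)
  have lim: "(\<lambda>n. op_poly (p n) A) \<longlonglongrightarrow> B"
    if "uniform_limit (real_spectrum A) (\<lambda>n. poly (p n)) f sequentially" for p
    using tendsto_add[OF op_poly_diff_tendsto_0[OF that q] B] by simp
  have "op_fun f A = B"
    unfolding op_fun_def
  proof (rule the_equality)
    show "\<forall>p. uniform_limit (real_spectrum A) (\<lambda>n. poly (p n)) f sequentially
      \<longrightarrow> (\<lambda>n. op_poly (p n) A) \<longlonglongrightarrow> B" using lim by blast
    fix C assume "\<forall>p. uniform_limit (real_spectrum A) (\<lambda>n. poly (p n)) f sequentially
      \<longrightarrow> (\<lambda>n. op_poly (p n) A) \<longlonglongrightarrow> C"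
    then show "C = B" using q B LIMSEQ_unique by blast
  qed
  then show ?thesis using lim[OF p] by simp
qed

lemma op_fun_approx:
  assumes f: "continuous_on {0..norm A} f"
  obtains p where "uniform_limit (real_spectrum A) (\<lambda>n. poly (p n)) f sequentially"
    "(\<lambda>n. op_poly (p n) A) \<longlonglongrightarrow> op_fun f A"
proof -
  obtain p where "uniform_limit {0..norm A} (\<lambda>n. poly (p n)) f sequentially"
    using weierstrass_poly[OF f] .
  then have "uniform_limit (real_spectrum A) (\<lambda>n. poly (p n)) f sequentially"
    by (rule uniform_limit_on_subset) (rule real_spectrum_bounds)
  with op_fun_limit[OF f this] show thesis by (rule that[rotated])
qed

lemma op_fun_poly: "op_fun (poly q) A = op_poly q A"
  by (rule LIMSEQ_unique[OF op_fun_limit[of "poly q" "\<lambda>_. q"]])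
     (auto intro!: continuous_intros simp: uniform_limit_iff)

text \<open>
  Approximating polynomials respect \<open>f \<le> g\<close> on the spectrum only up to an error \<open>e\<close>, so the
  inequality is first obtained with the error term \<open>e \<parallel>x\<parallel>\<^sup>2\<close>.
\<close>

lemma op_fun_mono:
  assumes f: "continuous_on {0..norm A} f" and g: "continuous_on {0..norm A} g"
    and le: "\<And>t. 0 \<le> t \<Longrightarrow> f t \<le> g t"
  shows "inner (op_fun f A x) x \<le> inner (op_fun g A x) x"
proof -
  obtain p where p: "uniform_limit (real_spectrum A) (\<lambda>n. poly (p n)) f sequentially"
    "(\<lambda>n. op_poly (p n) A) \<longlonglongrightarrow> op_fun f A" by (rule op_fun_approx[OF f])
  obtain q where q: "uniform_limit (real_spectrum A) (\<lambda>n. poly (q n)) g sequentially"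
    "(\<lambda>n. op_poly (q n) A) \<longlonglongrightarrow> op_fun g A" by (rule op_fun_approx[OF g])
  have "inner (op_fun f A x) x \<le> inner (op_fun g A x) x + e * (norm x)\<^sup>2" if e: "e > 0" for e
  proof (rule tendsto_le[OF sequentially_bot])
    show "(\<lambda>n. inner (op_poly (p n) A x) x) \<longlonglongrightarrow> inner (op_fun f A x) x"
      by (intro tendsto_intros p)
    show "(\<lambda>n. inner (op_poly (q n) A x) x + e * (norm x)\<^sup>2) \<longlonglongrightarrow> inner (op_fun g A x) x + e * (norm x)\<^sup>2"
      by (intro tendsto_intros q)
    have "\<forall>\<^sub>F n in sequentially. \<forall>t\<in>real_spectrum A. dist (poly (p n) t) (f t) < e / 2"
      "\<forall>\<^sub>F n in sequentially. \<forall>t\<in>real_spectrum A. dist (poly (q n) t) (g t) < e / 2"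
      using uniform_limitD[OF p(1), of "e / 2"] uniform_limitD[OF q(1), of "e / 2"] e by simp_all
    then show "\<forall>\<^sub>F n in sequentially. inner (op_poly (p n) A x) x \<le> inner (op_poly (q n) A x) x + e * (norm x)\<^sup>2"
    proof eventually_elim
      case (elim n)
      have "0 \<le> inner (op_poly (q n - p n + [:e:]) A x) x"
      proof (rule op_poly_nonneg)
        fix t assume t: "t \<in> real_spectrum A"
        then have "dist (poly (p n) t) (f t) < e / 2" "dist (poly (q n) t) (g t) < e / 2"
          using elim by auto
        moreover have "f t \<le> g t" using real_spectrum_bounds t le by auto
        ultimately have "0 \<le> poly (q n) t - poly (p n) t + e"
          unfolding dist_real_def by argo
        then show "0 \<le> poly (q n - p n + [:e:]) t" by simp
      qed
      then show ?case
        by (simp add: op_poly_diff op_poly_add op_poly_pCons blinfun.diff_left blinfun.add_left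
            blinfun.scaleR_left inner_diff_left inner_add_left power2_norm_eq_inner)
    qed
  qed
  then have "\<forall>\<^sub>F e in at_right 0. inner (op_fun f A x) x \<le> inner (op_fun g A x) x + e * (norm x)\<^sup>2"
    by (rule eventually_mono[OF eventually_at_right_less])
  moreover have "((\<lambda>e. inner (op_fun g A x) x + e * (norm x)\<^sup>2) \<longlongrightarrow> inner (op_fun g A x) x + 0 * (norm x)\<^sup>2) (at_right 0)"
    by (intro tendsto_intros)
  ultimately show ?thesis using tendsto_lowerbound by fastforce
qed

lemma op_fun_mult_poly:
  assumes f: "continuous_on {0..norm A} f"
  shows "op_fun (\<lambda>t. poly q t * f t) A = op_poly q A o\<^sub>L op_fun f A"
proof -
  obtain p where p: "uniform_limit (real_spectrum A) (\<lambda>n. poly (p n)) f sequentially"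
    "(\<lambda>n. op_poly (p n) A) \<longlonglongrightarrow> op_fun f A" by (rule op_fun_approx[OF f])
  have bdd: "bounded (h ` real_spectrum A)" if "continuous_on {0..norm A} h" for h :: "real \<Rightarrow> real"
    using compact_imp_bounded[OF compact_continuous_image[OF that compact_Icc]] real_spectrum_bounds
    by (meson bounded_subset image_mono)
  have "uniform_limit (real_spectrum A) (\<lambda>n t. poly q t * poly (p n) t) (\<lambda>t. poly q t * f t) sequentially"
    by (intro uniform_lim_mult p bdd f) (auto simp: uniform_limit_iff intro!: continuous_intros)
  moreover have "poly (q * p n) = (\<lambda>t. poly q t * poly (p n) t)" for n by auto
  ultimately have "(\<lambda>n. op_poly (q * p n) A) \<longlonglongrightarrow> op_fun (\<lambda>t. poly q t * f t) A"
    by (intro op_fun_limit) (auto intro!: continuous_intros f)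
  moreover have "(\<lambda>n. op_poly (q * p n) A) \<longlonglongrightarrow> (op_poly q A o\<^sub>L op_fun f A)"
    unfolding op_poly_mult by (intro tendsto_intros p)
  ultimately show ?thesis by (rule LIMSEQ_unique)
qed

end

section \<open>The Fujii--Seo determinant\<close>

text \<open>
  The substitution \<open>p \<mapsto> p(X + e)\<close> is a bijection between the polynomial sequences that
  approximate \<open>f\<close> on the spectrum of \<open>A + e\<close> and those that approximate \<open>f(t + e)\<close> on the spectrum of
  \<open>A\<close>, so the two defining conditions are equivalent. It reduces all the operators
  \<open>log (A + e)\<close> to functions of the single operator \<open>A\<close>.
\<close>

lemma op_fun_shift: "op_fun f (A + e *\<^sub>R id_blinfun) = op_fun (\<lambda>t. f (t + e)) A"
proof -
  let ?B = "A + e *\<^sub>R id_blinfun"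
  have UL: "uniform_limit (real_spectrum ?B) g f sequentially \<longleftrightarrow>
      uniform_limit (real_spectrum A) (\<lambda>n t. g n (t + e)) (\<lambda>t. f (t + e)) sequentially" for g :: "nat \<Rightarrow> real \<Rightarrow> real"
  proof -
    have ball: "(\<forall>s\<in>real_spectrum ?B. P s) \<longleftrightarrow> (\<forall>t\<in>real_spectrum A. P (t + e))" for P
    proof
      assume *: "\<forall>s\<in>real_spectrum ?B. P s"
      show "\<forall>t\<in>real_spectrum A. P (t + e)"
        using * real_spectrum_shift[of _ e A] by blast
    next
      assume *: "\<forall>t\<in>real_spectrum A. P (t + e)"
      show "\<forall>s\<in>real_spectrum ?B. P s"
      proof
        fix s assume "s \<in> real_spectrum ?B"
        then have "s - e \<in> real_spectrum A" using real_spectrum_shift[of "s - e" e A] by simp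
        with * have "P (s - e + e)" by blast
        then show "P s" by simp
      qed
    qed
    show ?thesis unfolding uniform_limit_iff ball ..
  qed
  have "(\<forall>p. uniform_limit (real_spectrum ?B) (\<lambda>n. poly (p n)) f sequentially
        \<longrightarrow> (\<lambda>n. op_poly (p n) ?B) \<longlonglongrightarrow> C) \<longleftrightarrow>
      (\<forall>p. uniform_limit (real_spectrum A) (\<lambda>n. poly (p n)) (\<lambda>t. f (t + e)) sequentially
        \<longrightarrow> (\<lambda>n. op_poly (p n) A) \<longlonglongrightarrow> C)" (is "?L \<longleftrightarrow> ?R") for C
  proof
    assume L: ?L
    show ?R
    proof (intro allI impI)
      fix p assume "uniform_limit (real_spectrum A) (\<lambda>n. poly (p n)) (\<lambda>t. f (t + e)) sequentially"
      then have "uniform_limit (real_spectrum ?B) (\<lambda>n. poly (p n \<circ>\<^sub>p [:- e, 1:])) f sequentially"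
        unfolding UL by (simp add: poly_pcompose)
      then have "(\<lambda>n. op_poly (p n \<circ>\<^sub>p [:- e, 1:]) ?B) \<longlonglongrightarrow> C"
        by (rule L[rule_format, of "\<lambda>n. p n \<circ>\<^sub>p [:- e, 1:]"])
      then show "(\<lambda>n. op_poly (p n) A) \<longlonglongrightarrow> C" by (simp add: op_poly_pcompose)
    qed
  next
    assume R: ?R
    show ?L
    proof (intro allI impI)
      fix p assume "uniform_limit (real_spectrum ?B) (\<lambda>n. poly (p n)) f sequentially"
      then have "uniform_limit (real_spectrum A) (\<lambda>n. poly (p n \<circ>\<^sub>p [:e, 1:])) (\<lambda>t. f (t + e)) sequentially"
        unfolding UL poly_pcompose by (simp add: add.commute)
      then have "(\<lambda>n. op_poly (p n \<circ>\<^sub>p [:e, 1:]) A) \<longlonglongrightarrow> C"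
        by (rule R[rule_format, of "\<lambda>n. p n \<circ>\<^sub>p [:e, 1:]"])
      then show "(\<lambda>n. op_poly (p n) ?B) \<longlonglongrightarrow> C" by (simp add: op_poly_pcompose)
    qed
  qed
  then show ?thesis unfolding op_fun_def by presburger
qed

lemma tendsto_at_right_mono_ereal:
  fixes F :: "real \<Rightarrow> real"
  assumes mono: "\<And>d e. 0 < d \<Longrightarrow> d \<le> e \<Longrightarrow> F d \<le> F e"
  shows "((\<lambda>e. ereal (F e)) \<longlongrightarrow> (INF e\<in>{0<..}. ereal (F e))) (at_right 0)"
proof (rule order_tendstoI)
  fix a assume a: "a < (INF e\<in>{0<..}. ereal (F e))"
  have "\<forall>\<^sub>F e in at_right (0::real). 0 < e" by (simp add: eventually_at_right_less)
  then show "\<forall>\<^sub>F e in at_right 0. a < ereal (F e)"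
    by eventually_elim (use less_INF_D[OF a] in simp)
next
  fix a assume "(INF e\<in>{0<..}. ereal (F e)) < a"
  then obtain e0 where e0: "e0 > 0" "ereal (F e0) < a" by (auto simp: INF_less_iff)
  have "\<forall>\<^sub>F e in at_right 0. e \<in> {0<..<e0}" using e0 by (intro eventually_at_right_real)
  then show "\<forall>\<^sub>F e in at_right 0. ereal (F e) < a"
  proof eventually_elim
    case (elim e)
    then have "ereal (F e) \<le> ereal (F e0)" using mono[of e e0] by simp
    then show ?case using e0(2) by (rule le_less_trans)
  qed
qed

lemma square_mult_ln_ge:
  assumes "0 \<le> t" "0 < (e::real)"
  shows "t\<^sup>2 - t \<le> t\<^sup>2 * ln (t + e)"
proof (cases "t = 0")
  case False
  then have t: "t > 0" using assms by simp
  have "1 - 1 / t \<le> ln t" using ln_le_minus_one[of "1 / t"] t by (simp add: ln_div)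
  also have "\<dots> \<le> ln (t + e)" using t assms by simp
  finally have "t\<^sup>2 * (1 - 1 / t) \<le> t\<^sup>2 * ln (t + e)" by (simp add: mult_left_mono)
  moreover have "t\<^sup>2 * (1 - 1 / t) = t\<^sup>2 - t" using t by (simp add: field_simps power2_eq_square)
  ultimately show ?thesis by simp
qed simp

context positive_op begin

lemma continuous_on_ln_shift: "e > 0 \<Longrightarrow> continuous_on {0..norm A} (\<lambda>t. ln (t + e))"
  by (auto intro!: continuous_intros)

text \<open>
  Monotonicity in the shift is what makes the limit in the definition of the determinant exist.
\<close>

lemma log_form_mono:
  assumes "0 < d" "d \<le> e"
  shows "inner (op_fun ln (A + d *\<^sub>R id_blinfun) x) x \<le> inner (op_fun ln (A + e *\<^sub>R id_blinfun) x) x"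
  unfolding op_fun_shift
  by (rule op_fun_mono) (use assms in \<open>auto intro!: continuous_on_ln_shift\<close>)

text \<open>
  This is \<open>A log (A + e) A \<ge> A\<^sup>2 - A\<close>, the image of \<open>square_mult_ln_ge\<close> under the functional
  calculus. The factor \<open>t\<^sup>2\<close> tames the singularity of the logarithm, so the bound is uniform in \<open>e\<close>.
\<close>

lemma log_form_lower_bound:
  assumes e: "e > 0"
  shows "(norm (A y))\<^sup>2 - inner (A y) y \<le> inner (op_fun ln (A + e *\<^sub>R id_blinfun) (A y)) (A y)"
proof -
  define f where "f t = ln (t + e)" for t
  have f: "continuous_on {0..norm A} f" unfolding f_def by (rule continuous_on_ln_shift[OF e])
  define X where "X = [:0, 1:: real:]"
  have X: "op_poly X A = A" by (auto simp: X_def op_poly_pCons intro!: blinfun_eqI)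
  have XX: "op_poly (X * X - X) A = (A o\<^sub>L A) - A" by (simp add: op_poly_diff op_poly_mult X)
  have comm: "A (op_fun f A z) = op_fun f A (A z)" for z
  proof -
    obtain p where p: "(\<lambda>n. op_poly (p n) A) \<longlonglongrightarrow> op_fun f A" by (rule op_fun_approx[OF f])
    have "(\<lambda>n. op_poly X A o\<^sub>L op_poly (p n) A) \<longlonglongrightarrow> (op_poly X A o\<^sub>L op_fun f A)"
      "(\<lambda>n. op_poly (p n) A o\<^sub>L op_poly X A) \<longlonglongrightarrow> (op_fun f A o\<^sub>L op_poly X A)"
      by (intro tendsto_intros p)+
    moreover have "op_poly X A o\<^sub>L op_poly (p n) A = op_poly (p n) A o\<^sub>L op_poly X A" for n
      by (simp add: op_poly_mult[symmetric] mult.commute)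
    ultimately have "op_poly X A o\<^sub>L op_fun f A = op_fun f A o\<^sub>L op_poly X A"
      by (simp add: LIMSEQ_unique)
    then have "(op_poly X A o\<^sub>L op_fun f A) z = (op_fun f A o\<^sub>L op_poly X A) z" by (rule arg_cong)
    then show ?thesis by (simp add: X)
  qed
  have "inner (op_poly (X * X - X) A y) y \<le> inner (op_fun (\<lambda>t. poly (X * X) t * f t) A y) y"
    unfolding op_fun_poly[symmetric]
  proof (rule op_fun_mono)
    show "poly (X * X - X) t \<le> poly (X * X) t * f t" if "0 \<le> t" for t
      using square_mult_ln_ge[OF that e] by (simp add: X_def f_def power2_eq_square algebra_simps)
  qed (auto intro!: continuous_intros f)
  also have "op_fun (\<lambda>t. poly (X * X) t * f t) A y = A (op_fun f A (A y))"
    by (simp only: op_fun_mult_poly[OF f] op_poly_mult X blinfun_apply_blinfun_compose comm)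
  also have "inner (A (op_fun f A (A y))) y = inner (op_fun f A (A y)) (A y)" by (rule symmetric)
  also have "f = (\<lambda>t. ln (t + e))" by (auto simp: f_def)
  also have "op_poly (X * X - X) A y = A (A y) - A y" by (simp add: XX blinfun.diff_left)
  also have "inner (A (A y) - A y) y = (norm (A y))\<^sup>2 - inner (A y) y"
    by (simp only: inner_diff_left symmetric[of "A y" y] power2_norm_eq_inner)
  finally show ?thesis unfolding op_fun_shift .
qed

text \<open>
  The determinant condition is used for the normalized vectors \<open>A y / \<parallel>A y\<parallel>\<close>. By the preceding lower
  bound it yields \<open>\<parallel>A y\<parallel>\<^sup>2 \<le> \<langle>A y, y\<rangle>\<close>, and the Cauchy--Schwarz inequality then gives
  \<open>\<parallel>A y\<parallel> \<le> \<parallel>y\<parallel>\<close>.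
\<close>

lemma form_le_of_fujii_seo_det_le_one:
  assumes det: "\<And>x. norm x = 1 \<Longrightarrow> fujii_seo_det x A \<le> 1"
  shows "inner (A y) y \<le> (norm y)\<^sup>2"
proof -
  have "(norm (A y))\<^sup>2 \<le> inner (A y) y"
  proof (cases "A y = 0")
    case False
    define n where "n = norm (A y)"
    have n: "n > 0" using False by (simp add: n_def)
    define x where "x = A ((1 / n) *\<^sub>R y)"
    have x1: "norm x = 1" using n by (simp add: x_def blinfun.scaleR_right n_def)
    define F where "F e = inner (op_fun ln (A + e *\<^sub>R id_blinfun) x) x" for e
    define l where "l = (INF e\<in>{0<..}. ereal (F e))"
    have "((\<lambda>e. ereal (F e)) \<longlongrightarrow> l) (at_right 0)"
      unfolding l_def by (rule tendsto_at_right_mono_ereal) (simp add: F_def log_form_mono)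
    then have "Lim (at_right 0) (\<lambda>e. ereal (F e)) = l" by (intro tendsto_Lim) auto
    then have "fujii_seo_det x A = ereal_exp l"
      by (simp add: fujii_seo_det_def F_def inner_cinner)
    then have "ereal_exp l \<le> 1" using det[OF x1] by simp
    then have l0: "l \<le> 0" 
      by (cases l) (auto simp: ereal_exp_def one_ereal_def zero_ereal_def)
    define z where "z = (1 / n) *\<^sub>R y"
    have "ereal ((norm (A z))\<^sup>2 - inner (A z) z) \<le> l"
      unfolding l_def
    proof (rule INF_greatest)
      fix e :: real assume "e \<in> {0<..}"
      then have "(norm (A z))\<^sup>2 - inner (A z) z \<le> F e"
        unfolding F_def x_def z_def[symmetric] by (intro log_form_lower_bound) simp
      then show "ereal ((norm (A z))\<^sup>2 - inner (A z) z) \<le> ereal (F e)" by simp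
    qed
    with l0 have "(norm (A z))\<^sup>2 - inner (A z) z \<le> 0"
      by (auto simp: zero_ereal_def dest: order_trans)
    then have "(norm (A y))\<^sup>2 / n\<^sup>2 \<le> inner (A y) y / n\<^sup>2" using n
      by (simp add: z_def blinfun.scaleR_right power_divide power2_eq_square)
    then show ?thesis using n by (simp add: divide_le_cancel)
  qed simp
  then have "norm (A y) * norm (A y) \<le> norm y * norm (A y)"
    using norm_cauchy_schwarz[of "A y" y] by (simp add: power2_eq_square mult.commute)
  then have "norm (A y) \<le> norm y" by (cases "A y = 0") auto
  then have "norm (A y) * norm y \<le> (norm y)\<^sup>2" by (simp add: power2_eq_square mult_right_mono)
  then show ?thesis using norm_cauchy_schwarz[of "A y" y] by linarith
qed

end

section \<open>Second derivatives and the Levi operator\<close>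

text \<open>
  The derivatives are carried as explicit functions into the bounded linear maps, so that linear
  combinations of such functions can be formed without computing derivatives again.
\<close>

locale C2_fun =
  fixes \<Omega> :: "'a::real_normed_vector set" and u :: "'a \<Rightarrow> real"
    and u1 :: "'a \<Rightarrow> 'a \<Rightarrow>\<^sub>L real" and u2 :: "'a \<Rightarrow> 'a \<Rightarrow>\<^sub>L 'a \<Rightarrow>\<^sub>L real"
  assumes open_domain: "open \<Omega>"
    and deriv1: "z \<in> \<Omega> \<Longrightarrow> (u has_derivative blinfun_apply (u1 z)) (at z)"
    and deriv2: "z \<in> \<Omega> \<Longrightarrow> (u1 has_derivative blinfun_apply (u2 z)) (at z)"
    and cont2: "continuous_on \<Omega> u2"
begin

lemma cont0: "continuous_on \<Omega> u"
  using deriv1 by (meson continuous_at_imp_continuous_on has_derivative_continuous)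

lemma cont1: "continuous_on \<Omega> u1"
  using deriv2 by (meson continuous_at_imp_continuous_on has_derivative_continuous)

lemma D1_eq: "z \<in> \<Omega> \<Longrightarrow> D1 u z = u1 z"
  unfolding D1_def by (simp add: frechet_derivative_at[OF deriv1, symmetric] blinfun_apply_inverse)

lemma D2_eq:
  assumes "z \<in> \<Omega>"
  shows "D2 u z s t = u2 z s t"
proof -
  have "(D1 u has_derivative blinfun_apply (u2 z)) (at z)"
    by (rule has_derivative_transform_within_open[OF deriv2 open_domain]) (use assms D1_eq in auto)
  then show ?thesis by (simp add: D2_def frechet_derivative_at[symmetric])
qed

lemma deriv_along_curve:
  assumes "(\<gamma> has_vector_derivative \<gamma>') (at t within S)" "\<gamma> t \<in> \<Omega>"
  shows "((\<lambda>t. u (\<gamma> t)) has_real_derivative u1 (\<gamma> t) \<gamma>') (at t within S)"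
proof -
  have "((\<lambda>t. u (\<gamma> t)) has_derivative (\<lambda>x. u1 (\<gamma> t) (x *\<^sub>R \<gamma>'))) (at t within S)"
    by (rule has_derivative_compose[OF assms(1)[unfolded has_vector_derivative_def] deriv1[OF assms(2)]])
  then show ?thesis unfolding has_field_derivative_def
    by (rule has_derivative_eq_rhs) (auto simp: blinfun.scaleR_right mult.commute)
qed

lemma deriv1_along_curve:
  assumes g: "(\<gamma> has_vector_derivative \<gamma>') (at t within S)" "\<gamma> t \<in> \<Omega>"
    and e: "(\<eta> has_vector_derivative \<eta>') (at t within S)"
  shows "((\<lambda>t. u1 (\<gamma> t) (\<eta> t)) has_real_derivative u2 (\<gamma> t) \<gamma>' (\<eta> t) + u1 (\<gamma> t) \<eta>') (at t within S)"
proof -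
  have "((\<lambda>t. u1 (\<gamma> t)) has_derivative (\<lambda>x. u2 (\<gamma> t) (x *\<^sub>R \<gamma>'))) (at t within S)"
    by (rule has_derivative_compose[OF g(1)[unfolded has_vector_derivative_def] deriv2[OF g(2)]])
  from bounded_bilinear.FDERIV[OF bounded_bilinear_blinfun_apply this e[unfolded has_vector_derivative_def]]
  have "((\<lambda>t. u1 (\<gamma> t) (\<eta> t)) has_derivative
      (\<lambda>x. u1 (\<gamma> t) (x *\<^sub>R \<eta>') + u2 (\<gamma> t) (x *\<^sub>R \<gamma>') (\<eta> t))) (at t within S)" .
  then show ?thesis unfolding has_field_derivative_def
    by (rule has_derivative_eq_rhs)
       (auto simp: blinfun.scaleR_right blinfun.scaleR_left algebra_simps)
qed

text \<open>
  The mean value theorem is applied first in the direction \<open>s\<close> and then in the direction \<open>t\<close>. The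
  second difference is symmetric in \<open>s\<close> and \<open>t\<close>, whereas the right-hand side is not; comparing both
  orders gives the symmetry of the second derivative.
\<close>

lemma second_difference:
  assumes r: "ball a r \<subseteq> \<Omega>" and e: "e > 0" "e * (norm s + norm t) < r"
  shows "\<exists>p\<in>ball a r. u (a + e *\<^sub>R s + e *\<^sub>R t) - u (a + e *\<^sub>R s) - u (a + e *\<^sub>R t) + u a = e\<^sup>2 * u2 p t s"
proof -
  have inb: "a + x *\<^sub>R s + y *\<^sub>R t \<in> ball a r" if "0 \<le> x" "x \<le> e" "0 \<le> y" "y \<le> e" for x y
  proof -
    have "norm (x *\<^sub>R s + y *\<^sub>R t) \<le> x * norm s + y * norm t"
      using norm_triangle_ineq[of "x *\<^sub>R s" "y *\<^sub>R t"] that by simp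
    also have "\<dots> \<le> e * norm s + e * norm t"
      using that by (intro add_mono mult_right_mono) auto
    finally have *: "norm (x *\<^sub>R s + y *\<^sub>R t) < r" using e by (simp add: distrib_left)
    have "dist a (a + x *\<^sub>R s + y *\<^sub>R t) = norm (x *\<^sub>R s + y *\<^sub>R t)"
      using norm_minus_cancel[of "x *\<^sub>R s + y *\<^sub>R t"] by (simp add: dist_norm algebra_simps)
    with * show ?thesis by simp
  qed
  have curve: "((\<lambda>x. b + x *\<^sub>R w) has_vector_derivative w) (at x)" for b w :: 'a and x
    by (auto intro!: derivative_eq_intros)
  define g where "g x = u (a + e *\<^sub>R t + x *\<^sub>R s) - u (a + x *\<^sub>R s)" for x
  have g: "(g has_real_derivative (u1 (a + e *\<^sub>R t + x *\<^sub>R s) s - u1 (a + x *\<^sub>R s) s)) (at x)"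
    if "0 \<le> x" "x \<le> e" for x
    unfolding g_def using inb[of x e] inb[of x 0] that e r
    by (intro DERIV_diff deriv_along_curve curve) (auto simp: algebra_simps)
  obtain x where x: "0 < x" "x < e"
    and gx: "g e - g 0 = (e - 0) * (u1 (a + e *\<^sub>R t + x *\<^sub>R s) s - u1 (a + x *\<^sub>R s) s)"
    using MVT2[OF e(1) g] by blast
  define k where "k y = u1 (a + x *\<^sub>R s + y *\<^sub>R t) s" for y
  have k: "(k has_real_derivative u2 (a + x *\<^sub>R s + y *\<^sub>R t) t s) (at y)" if "0 \<le> y" "y \<le> e" for y
    using deriv1_along_curve[OF curve[of "a + x *\<^sub>R s" t y] _ has_vector_derivative_const[of s]] inb[of x y] that x r
    unfolding k_def by auto
  obtain y where y: "0 < y" "y < e" and ky: "k e - k 0 = (e - 0) * u2 (a + x *\<^sub>R s + y *\<^sub>R t) t s"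
    using MVT2[OF e(1) k] by blast
  have "u (a + e *\<^sub>R s + e *\<^sub>R t) - u (a + e *\<^sub>R s) - u (a + e *\<^sub>R t) + u a = g e - g 0"
    by (simp add: g_def algebra_simps)
  also have "\<dots> = e * (k e - k 0)" unfolding gx k_def by (simp add: algebra_simps)
  also have "\<dots> = e\<^sup>2 * u2 (a + x *\<^sub>R s + y *\<^sub>R t) t s" unfolding ky by (simp add: power2_eq_square)
  finally show ?thesis using inb[of x y] x y by auto
qed

lemma second_derivative_symmetric:
  assumes a: "a \<in> \<Omega>"
  shows "u2 a s t = u2 a t s"
proof (rule ccontr)
  assume ne: "u2 a s t \<noteq> u2 a t s"
  define d where "d = \<bar>u2 a s t - u2 a t s\<bar> / 2"
  have d: "d > 0" using ne by (simp add: d_def)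
  have cont: "isCont (\<lambda>p. u2 p v w) a" for v w
    using cont2 a open_domain by (auto intro!: continuous_intros simp: continuous_on_eq_continuous_at)
  obtain r1 where r1: "r1 > 0" "\<And>p. dist p a < r1 \<Longrightarrow> dist (u2 p s t) (u2 a s t) < d"
    using cont[of s t] d unfolding continuous_at_eps_delta by blast
  obtain r2 where r2: "r2 > 0" "\<And>p. dist p a < r2 \<Longrightarrow> dist (u2 p t s) (u2 a t s) < d"
    using cont[of t s] d unfolding continuous_at_eps_delta by blast
  obtain r3 where r3: "r3 > 0" "ball a r3 \<subseteq> \<Omega>" using open_domain a open_contains_ball by blast
  define r where "r = min r1 (min r2 r3)"
  have r: "r > 0" "ball a r \<subseteq> \<Omega>" using r1 r2 r3 by (auto simp: r_def)
  define e where "e = r / (2 * (norm s + norm t + 1))"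
  have N: "norm s + norm t + 1 > 0" by (simp add: add_nonneg_pos)
  have e: "e > 0" using r N by (simp add: e_def)
  have "e * (norm s + norm t) < e * (2 * (norm s + norm t + 1))"
  proof (rule mult_strict_left_mono[OF _ e])
    show "norm s + norm t < 2 * (norm s + norm t + 1)"
      using norm_ge_zero[of s] norm_ge_zero[of t] by argo
  qed
  also have "\<dots> = r" using N by (simp add: e_def)
  finally have er: "e * (norm s + norm t) < r" "e * (norm t + norm s) < r" by (simp_all add: add.commute)
  obtain p where p: "p \<in> ball a r"
    "u (a + e *\<^sub>R s + e *\<^sub>R t) - u (a + e *\<^sub>R s) - u (a + e *\<^sub>R t) + u a = e\<^sup>2 * u2 p t s"
    using second_difference[OF r(2) e er(1)] by blast
  obtain q where q: "q \<in> ball a r"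
    "u (a + e *\<^sub>R t + e *\<^sub>R s) - u (a + e *\<^sub>R t) - u (a + e *\<^sub>R s) + u a = e\<^sup>2 * u2 q s t"
    using second_difference[OF r(2) e er(2)] by blast
  have "e\<^sup>2 * u2 p t s = e\<^sup>2 * u2 q s t" using p(2) q(2) by (simp add: algebra_simps)
  then have "u2 p t s = u2 q s t" using e by simp
  moreover have "dist (u2 p t s) (u2 a t s) < d" using p(1) r2(2)[of p] by (simp add: r_def dist_commute)
  moreover have "dist (u2 q s t) (u2 a s t) < d" using q(1) r1(2)[of q] by (simp add: r_def dist_commute)
  ultimately show False unfolding d_def dist_real_def by argo
qed

end

locale C2_fun_complex = C2_fun \<Omega> u u1 u2
  for \<Omega> :: "'a::complex_hilbert set" and u u1 u2
begin

text \<open>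
  The Laplacian at \<open>\<lambda> = 0\<close> of the function \<open>\<lambda> \<mapsto> u(z + \<lambda> s)\<close>; it is four times the Levi form.
\<close>

definition lap :: "'a \<Rightarrow> 'a \<Rightarrow> real"
  where "lap z s = u2 z s s + u2 z (\<i> *\<^sub>C s) (\<i> *\<^sub>C s)"

text \<open>
  In the expansion the mixed terms cancel in pairs.
\<close>

lemma lap_scaleC: "lap z (w *\<^sub>C s) = (cmod w)\<^sup>2 * lap z s"
proof -
  define x y where "x = Re w" and "y = Im w"
  have w: "w = complex_of_real x + complex_of_real y * \<i>" by (simp add: x_def y_def complex_eq_iff)
  have 1: "w *\<^sub>C s = x *\<^sub>R s + y *\<^sub>R (\<i> *\<^sub>C s)"
    by (simp add: w scaleC_add_left scaleR_scaleC scaleC_scaleC)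
  have 2: "\<i> *\<^sub>C w *\<^sub>C s = x *\<^sub>R (\<i> *\<^sub>C s) - y *\<^sub>R s"
    unfolding 1 using ii_scaleC[of "y *\<^sub>R s"]
    by (simp add: scaleC_add_right scaleR_scaleC scaleC_scaleC mult.commute)
  have "(cmod w)\<^sup>2 = x\<^sup>2 + y\<^sup>2" by (simp add: cmod_power2 x_def y_def)
  then show ?thesis unfolding lap_def 2 unfolding 1
    by (simp add: blinfun.add_left blinfun.add_right blinfun.diff_left blinfun.diff_right
        blinfun.scaleR_left blinfun.scaleR_right power2_eq_square algebra_simps)
qed

lemma levi_form_eq:
  "z \<in> \<Omega> \<Longrightarrow> levi_form u z s t =
    Complex ((u2 z s t + u2 z (\<i> *\<^sub>C s) (\<i> *\<^sub>C t)) / 4) ((u2 z s (\<i> *\<^sub>C t) - u2 z (\<i> *\<^sub>C s) t) / 4)"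
  unfolding levi_form_def by (simp add: D2_eq complex_eq_iff)

text \<open>
  For fixed \<open>s\<close>, the Riesz theorem represents the real part of the Levi form as
  \<open>\<langle>W s, t\<rangle>\<close>. Replacing \<open>t\<close> by \<open>i t\<close> recovers the imaginary part, so \<open>W\<close> is the operator that the
  definition of the Levi operator describes.
\<close>

lemma levi_op_inner:
  assumes z: "z \<in> \<Omega>"
  shows "inner (levi_op u z s) t = (u2 z s t + u2 z (\<i> *\<^sub>C s) (\<i> *\<^sub>C t)) / 4"
proof -
  define L where "L s t = (u2 z s t + u2 z (\<i> *\<^sub>C s) (\<i> *\<^sub>C t)) / 4" for s t
  have blc: "bounded_linear (\<lambda>t. blinfun_apply B (\<i> *\<^sub>C t))" for B :: "'a \<Rightarrow>\<^sub>L real"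
    using bounded_linear_compose[OF blinfun.bounded_linear_right bounded_linear_scaleC_right] .
  have "bounded_linear (L s)" for s
    unfolding L_def
    by (rule bounded_linear_compose[OF bounded_linear_divide
        bounded_linear_add[OF blinfun.bounded_linear_right blc]])
  then have "\<forall>s. \<exists>v. \<forall>t. L s t = inner v t" using riesz_representation by blast
  then obtain w where w: "\<And>s t. inner (w s) t = L s t" by metis
  have eqI: "x = y" if "\<And>t. inner x t = inner y t" for x y :: 'a
    using that vector_eq_rdot by blast
  have "bounded_linear w"
  proof (rule bounded_linear_intro[of _ "norm (u2 z)"])
    show "w (x + y) = w x + w y" for x y
      by (rule eqI) (simp add: w L_def inner_add_left scaleC_add_right blinfun.add_left blinfun.add_right add_divide_distrib)
    show "w (r *\<^sub>R x) = r *\<^sub>R w x" for r x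
    proof (rule eqI)
      have "\<i> *\<^sub>C r *\<^sub>R x = r *\<^sub>R \<i> *\<^sub>C x" by (simp add: scaleR_scaleC scaleC_scaleC mult.commute)
      then show "inner (w (r *\<^sub>R x)) t = inner (r *\<^sub>R w x) t" for t
        by (simp add: w L_def blinfun.scaleR_left blinfun.scaleR_right distrib_left)
    qed
    show "norm (w x) \<le> norm x * norm (u2 z)" for x
    proof (cases "w x = 0")
      case False
      have B: "\<bar>u2 z a b\<bar> \<le> norm (u2 z) * norm a * norm b" for a b
        using norm_blinfun[of "u2 z a" b] mult_right_mono[OF norm_blinfun[of "u2 z" a], of "norm b"]
        by simp
      have "(norm (w x))\<^sup>2 = L x (w x)" by (simp add: w[symmetric] power2_norm_eq_inner)
      also have "\<dots> \<le> norm (u2 z) * norm x * norm (w x)"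
      proof -
        have "0 \<le> norm (u2 z) * norm x * norm (w x)" by simp
        then show ?thesis
          using B[of x "w x"] B[of "\<i> *\<^sub>C x" "\<i> *\<^sub>C w x"] unfolding L_def norm_scaleC norm_ii mult_1 by argo
      qed
      finally show ?thesis using False by (simp add: power2_eq_square mult.commute)
    qed simp
  qed
  define W where "W = Blinfun w"
  have W: "inner (W s) t = L s t" for s t
    unfolding W_def bounded_linear_Blinfun_apply[OF \<open>bounded_linear w\<close>] by (rule w)
  have cW: "cinner (W s) t = levi_form u z s t" for s t
  proof (rule complex_eqI)
    show "Re (cinner (W s) t) = Re (levi_form u z s t)"
      using W[of s t] by (simp add: levi_form_eq[OF z] L_def inner_cinner)
    have "Im (cinner (W s) t) = Re (cinner (W s) (\<i> *\<^sub>C t))" by (simp add: cinner_scaleC_right)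
    also have "\<dots> = L s (\<i> *\<^sub>C t)" using W[of s "\<i> *\<^sub>C t"] by (simp add: inner_cinner)
    also have "\<dots> = Im (levi_form u z s t)"
      by (simp add: levi_form_eq[OF z] L_def ii_scaleC blinfun.minus_right)
    finally show "Im (cinner (W s) t) = Im (levi_form u z s t)" .
  qed
  have "levi_op u z = W"
    unfolding levi_op_def
  proof (rule the_equality)
    show "\<forall>s t. cinner (W s) t = levi_form u z s t" using cW by blast
    fix A assume A: "\<forall>s t. cinner (blinfun_apply A s) t = levi_form u z s t"
    show "A = W"
    proof (rule blinfun_eqI, rule eqI)
      show "inner (A s) t = inner (W s) t" for s t using A cW by (simp add: inner_cinner)
    qed
  qed
  then show ?thesis using W by (simp add: L_def)
qed

lemma levi_op_form: "z \<in> \<Omega> \<Longrightarrow> inner (levi_op u z s) s = lap z s / 4"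
  by (simp add: levi_op_inner lap_def)

lemma levi_op_positive:
  assumes z: "z \<in> \<Omega>" and "\<And>s. lap z s \<ge> 0"
  shows "positive_op (levi_op u z)"
proof
  show "inner (levi_op u z s) t = inner s (levi_op u z t)" for s t
    using levi_op_inner[OF z, of s t] levi_op_inner[OF z, of t s]
    by (simp add: second_derivative_symmetric[OF z, of t] second_derivative_symmetric[OF z, of "\<i> *\<^sub>C t"] inner_commute)
  show "0 \<le> inner (levi_op u z s) s" for s using assms by (simp add: levi_op_form)
qed

end

section \<open>Circular means\<close>

context C2_fun_complex begin

text \<open>
  Let \<open>M(r)\<close> be the integral of \<open>u(z + r e\<^sup>i\<^sup>\<theta> h)\<close> over \<open>\<theta>\<close>. In polar coordinates \<open>r\<^sup>2\<close> times the
  Laplacian is \<open>r\<^sup>2 G\<^sub>r\<^sub>r + r G\<^sub>r + G\<^sub>\<theta>\<^sub>\<theta>\<close>, and the last term integrates to zero by periodicity. Hence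
  \<open>(r M')' \<ge> 2 \<pi> c r\<close>, so \<open>M' \<ge> \<pi> c r\<close> and \<open>M(1) - M(0) \<ge> \<pi> c / 2\<close>. The case \<open>c = 0\<close> is the
  sub-mean-value inequality; the case \<open>c > 0\<close>, applied to \<open>-u\<close>, shows that a function with the
  sub-mean-value property has no point of negative Laplacian.
\<close>

lemma mean_value_gap:
  assumes disc: "\<And>l. cmod l \<le> 1 \<Longrightarrow> z + l *\<^sub>C h \<in> \<Omega>"
    and lap: "\<And>l. cmod l \<le> 1 \<Longrightarrow> c \<le> lap (z + l *\<^sub>C h) h"
  shows "u z + c / 4 \<le> integral {0..2*pi} (\<lambda>\<theta>. u (z + cis \<theta> *\<^sub>C h)) / (2 * pi)"
proof -
  define e where "e \<theta> = cis \<theta> *\<^sub>C h" for \<theta>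
  define p where "p r \<theta> = z + r *\<^sub>R e \<theta>" for r \<theta>
  have p_alt: "p r \<theta> = z + (complex_of_real r * cis \<theta>) *\<^sub>C h" for r \<theta>
    by (simp add: p_def e_def scaleR_scaleC scaleC_scaleC)
  have p_in: "p r \<theta> \<in> \<Omega>" if "r \<in> {0..1}" for r \<theta>
    unfolding p_alt by (rule disc) (use that in \<open>simp add: norm_mult\<close>)
  have lap_p: "c \<le> lap (p r \<theta>) (e \<theta>)" if "r \<in> {0..1}" for r \<theta>
    using lap[of "complex_of_real r * cis \<theta>"] that
    by (simp add: p_alt e_def lap_scaleC norm_mult)
  have e': "(e has_vector_derivative \<i> *\<^sub>C e \<theta>) (at \<theta> within S)" for \<theta> S
  proof -
    have "(cis has_vector_derivative \<i> * cis \<theta>) (at \<theta> within S)"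
      unfolding has_vector_derivative_complex_iff
      by (auto intro!: derivative_eq_intros)
    from bounded_linear.has_vector_derivative[OF bounded_linear_scaleC_left[of h] this]
    show ?thesis by (simp add: e_def[abs_def] scaleC_scaleC)
  qed
  have cont_e: "continuous_on S e" for S
    using e' by (meson continuous_on_eq_continuous_within has_vector_derivative_continuous)
  have cont_p: "continuous_on ({0..1} \<times> {0..2*pi}) (\<lambda>(r,\<theta>). p r \<theta>)"
    unfolding p_def split_beta
    by (intro continuous_intros continuous_on_compose2[OF cont_e[of UNIV]]) auto
  have cont_e2: "continuous_on ({0..1} \<times> {0..2*pi}) (\<lambda>(r,\<theta>). e \<theta>)"
    unfolding split_beta by (intro continuous_on_compose2[OF cont_e[of UNIV]] continuous_intros) auto
  have pim: "(\<lambda>(r,\<theta>). p r \<theta>) ` ({0..1} \<times> {0..2*pi}) \<subseteq> \<Omega>" using p_in by auto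
  define G where "G r \<theta> = u (p r \<theta>)" for r \<theta>
  define G1 where "G1 r \<theta> = u1 (p r \<theta>) (e \<theta>)" for r \<theta>
  define G2 where "G2 r \<theta> = u2 (p r \<theta>) (e \<theta>) (e \<theta>)" for r \<theta>
  define K where "K r \<theta> = u2 (p r \<theta>) (\<i> *\<^sub>C e \<theta>) (\<i> *\<^sub>C e \<theta>)" for r \<theta>
  have cG: "continuous_on ({0..1} \<times> {0..2*pi}) (\<lambda>(r,\<theta>). G r \<theta>)"
    using continuous_on_compose2[OF cont0 cont_p pim] by (simp add: G_def split_beta)
  have cu1: "continuous_on ({0..1} \<times> {0..2*pi}) (\<lambda>(r,\<theta>). u1 (p r \<theta>))"
    using continuous_on_compose2[OF cont1 cont_p pim] by (simp add: split_beta)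
  have cu2: "continuous_on ({0..1} \<times> {0..2*pi}) (\<lambda>(r,\<theta>). u2 (p r \<theta>))"
    using continuous_on_compose2[OF cont2 cont_p pim] by (simp add: split_beta)
  have cG1: "continuous_on ({0..1} \<times> {0..2*pi}) (\<lambda>(r,\<theta>). G1 r \<theta>)"
    using cu1 cont_e2 unfolding G1_def split_beta by (intro continuous_intros)
  have cG2: "continuous_on ({0..1} \<times> {0..2*pi}) (\<lambda>(r,\<theta>). G2 r \<theta>)"
    using cu2 cont_e2 unfolding G2_def split_beta by (intro continuous_intros)
  have cK: "continuous_on ({0..1} \<times> {0..2*pi}) (\<lambda>(r,\<theta>). K r \<theta>)"
    using cu2 cont_e2 unfolding K_def split_beta
    by (intro continuous_intros bounded_linear.continuous_on[OF bounded_linear_scaleC_right])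
  have slice: "f r integrable_on {0..2*pi}"
    if "continuous_on ({0..1} \<times> {0..2*pi}) (\<lambda>(r,\<theta>). f r \<theta>)" "r \<in> {0..1}" for f :: "real \<Rightarrow> real \<Rightarrow> real" and r
  proof (rule integrable_continuous_interval)
    have "continuous_on {0..2*pi} (\<lambda>\<theta>. case (r, \<theta>) of (r,\<theta>) \<Rightarrow> f r \<theta>)"
      by (rule continuous_on_compose2[OF that(1)]) (use that(2) in \<open>auto intro!: continuous_intros\<close>)
    then show "continuous_on {0..2*pi} (f r)" by simp
  qed
  note int = slice[OF cG] slice[OF cG1] slice[OF cG2] slice[OF cK]
  have p_r: "((\<lambda>r. p r \<theta>) has_vector_derivative e \<theta>) (at r within S)" for r \<theta> S
    unfolding p_def by (auto intro!: derivative_eq_intros)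
  define M where "M r = integral {0..2*pi} (G r)" for r
  define M1 where "M1 r = integral {0..2*pi} (G1 r)" for r
  define M2 where "M2 r = integral {0..2*pi} (G2 r)" for r
  have dM: "(M has_real_derivative M1 r) (at r within {0..1})" if "r \<in> {0..1}" for r
    unfolding M_def M1_def
  proof (rule leibniz_rule_field_derivative[of _ 0 "2*pi", unfolded cbox_interval])
    show "((\<lambda>r. G r \<theta>) has_real_derivative G1 r \<theta>) (at r within {0..1})" if "r \<in> {0..1}" for r \<theta>
      unfolding G_def G1_def by (rule deriv_along_curve[OF p_r p_in[OF that]])
  qed (use that int(1) cG1 in auto)
  have dM1: "(M1 has_real_derivative M2 r) (at r within {0..1})" if "r \<in> {0..1}" for r
    unfolding M1_def M2_def
  proof (rule leibniz_rule_field_derivative[of _ 0 "2*pi", unfolded cbox_interval])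
    show "((\<lambda>r. G1 r \<theta>) has_real_derivative G2 r \<theta>) (at r within {0..1})" if "r \<in> {0..1}" for r \<theta>
      using deriv1_along_curve[OF p_r p_in[OF that] has_vector_derivative_const[of "e \<theta>"]]
      by (simp add: G1_def G2_def)
  qed (use that int(2) cG2 in auto)
  \<comment> \<open>the angular derivative \<open>G\<^sub>\<theta>\<close>, called \<open>w\<close> below, is periodic, so \<open>G\<^sub>\<theta>\<^sub>\<theta> = r\<^sup>2 K - r G1\<close> integrates to zero\<close>
  have angular: "r\<^sup>2 * integral {0..2*pi} (K r) = r * M1 r" if r: "r \<in> {0..1}" for r
  proof -
    define w where "w \<theta> = u1 (p r \<theta>) (r *\<^sub>R (\<i> *\<^sub>C e \<theta>))" for \<theta>
    have w': "(w has_real_derivative r\<^sup>2 * K r \<theta> - r * G1 r \<theta>) (at \<theta> within {0..2*pi})" for \<theta>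
    proof -
      have 1: "((\<lambda>\<theta>. p r \<theta>) has_vector_derivative r *\<^sub>R (\<i> *\<^sub>C e \<theta>)) (at \<theta> within {0..2*pi})"
        unfolding p_def by (auto intro!: derivative_eq_intros e')
      have "((\<lambda>\<theta>. \<i> *\<^sub>C e \<theta>) has_vector_derivative \<i> *\<^sub>C \<i> *\<^sub>C e \<theta>) (at \<theta> within {0..2*pi})"
        by (rule bounded_linear.has_vector_derivative[OF bounded_linear_scaleC_right e'])
      then have 2: "((\<lambda>\<theta>. r *\<^sub>R (\<i> *\<^sub>C e \<theta>)) has_vector_derivative - r *\<^sub>R e \<theta>) (at \<theta> within {0..2*pi})"
        unfolding ii_scaleC by (auto intro!: derivative_eq_intros)
      show ?thesis
        using deriv1_along_curve[OF 1 p_in[OF r] 2]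
        by (simp add: w_def[abs_def] K_def G1_def blinfun.scaleR_left blinfun.scaleR_right
            blinfun.minus_right power2_eq_square mult.assoc)
    qed
    have "((\<lambda>\<theta>. r\<^sup>2 * K r \<theta> - r * G1 r \<theta>) has_integral w (2*pi) - w 0) {0..2*pi}"
      by (rule fundamental_theorem_of_calculus)
         (use w' in \<open>auto simp: has_real_derivative_iff_has_vector_derivative\<close>)
    moreover have "((\<lambda>\<theta>. r\<^sup>2 * K r \<theta> - r * G1 r \<theta>) has_integral
        r\<^sup>2 * integral {0..2*pi} (K r) - r * M1 r) {0..2*pi}"
      unfolding M1_def
      by (intro has_integral_diff has_integral_mult_right integrable_integral int[OF r])
    ultimately have "w (2*pi) - w 0 = r\<^sup>2 * integral {0..2*pi} (K r) - r * M1 r"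
      by (rule has_integral_unique)
    moreover have "w (2*pi) = w 0" by (simp add: w_def p_def e_def)
    ultimately show ?thesis by simp
  qed
  have radial: "2 * pi * c * r \<le> M1 r + r * M2 r" if r: "0 < r" "r \<le> 1" for r
  proof -
    have r': "r \<in> {0..1}" using r by simp
    have "2 * pi * c = integral {0..2*pi} (\<lambda>_. c)" by simp
    also have "\<dots> \<le> integral {0..2*pi} (\<lambda>\<theta>. G2 r \<theta> + K r \<theta>)"
      using lap_p[OF r'] int[OF r']
      by (intro integral_le integrable_add) (auto simp: G2_def K_def lap_def)
    also have "\<dots> = M2 r + integral {0..2*pi} (K r)"
      using int[OF r'] by (simp add: integral_add M2_def)
    finally have "r\<^sup>2 * (2 * pi * c) \<le> r\<^sup>2 * (M2 r + integral {0..2*pi} (K r))"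
      by (simp add: mult_left_mono)
    also have "\<dots> = r * (M1 r + r * M2 r)"
      using angular[OF r'] by (simp add: algebra_simps power2_eq_square)
    finally have "r * (2 * pi * c * r) \<le> r * (M1 r + r * M2 r)" by (simp add: power2_eq_square algebra_simps)
    then show ?thesis using r by simp
  qed
  have inner_at: "at r within {0..1} = at r" if "0 < r" "r < 1" for r :: real
    using that by (rule at_within_Icc_at)
  have contM: "continuous_on {0..b} M" "continuous_on {0..b} M1" if "b \<le> 1" for b
    by (rule continuous_on_subset[OF DERIV_continuous_on[OF dM]], use that in auto)
      (rule continuous_on_subset[OF DERIV_continuous_on[OF dM1]], use that in auto)
  have M1: "pi * c * r \<le> M1 r" if r: "0 < r" "r < 1" for r
  proof -
    have "0 * M1 0 - pi * c * 0\<^sup>2 \<le> r * M1 r - pi * c * r\<^sup>2"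
    proof (rule DERIV_nonneg_imp_increasing_open[of 0 r "\<lambda>r. r * M1 r - pi * c * r\<^sup>2"])
      fix x assume x: "0 < x" "x < r"
      have "((\<lambda>r. r * M1 r - pi * c * r\<^sup>2) has_real_derivative (M1 x + x * M2 x - 2 * pi * c * x)) (at x)"
        using dM1[of x] x r inner_at[of x] by (auto intro!: derivative_eq_intros)
      moreover have "0 \<le> M1 x + x * M2 x - 2 * pi * c * x" using radial[of x] x r by simp
      ultimately show "\<exists>y. ((\<lambda>r. r * M1 r - pi * c * r\<^sup>2) has_real_derivative y) (at x) \<and> 0 \<le> y" by blast
    qed (use r contM(2)[of r] in \<open>auto intro!: continuous_intros\<close>)
    then have "r * (pi * c * r) \<le> r * M1 r" by (simp add: power2_eq_square algebra_simps)
    then show ?thesis using r by simp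
  qed
  have "M 0 - pi * c / 2 * 0\<^sup>2 \<le> M 1 - pi * c / 2 * 1\<^sup>2"
  proof (rule DERIV_nonneg_imp_increasing_open[of 0 1 "\<lambda>r. M r - pi * c / 2 * r\<^sup>2"])
    fix x :: real assume x: "0 < x" "x < 1"
    have "((\<lambda>r. M r - pi * c / 2 * r\<^sup>2) has_real_derivative (M1 x - pi * c * x)) (at x)"
      using dM[of x] x inner_at[of x] by (auto intro!: derivative_eq_intros)
    moreover have "0 \<le> M1 x - pi * c * x" using M1[of x] x by simp
    ultimately show "\<exists>y. ((\<lambda>r. M r - pi * c / 2 * r\<^sup>2) has_real_derivative y) (at x) \<and> 0 \<le> y" by blast
  qed (use contM(1)[of 1] in \<open>auto intro!: continuous_intros\<close>)
  moreover have "G 0 = (\<lambda>_. u z)" by (auto simp: G_def p_def)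
  then have "M 0 = 2 * pi * u z" by (simp add: M_def)
  moreover have "G 1 = (\<lambda>\<theta>. u (z + cis \<theta> *\<^sub>C h))" by (auto simp: G_def p_def e_def)
  then have "M 1 = integral {0..2*pi} (\<lambda>\<theta>. u (z + cis \<theta> *\<^sub>C h))" by (simp add: M_def)
  ultimately show ?thesis by (simp add: field_simps)
qed

end

lemma ereal_integral_continuous:
  fixes g :: "real \<Rightarrow> real"
  assumes g: "continuous_on {a..b} g"
  shows "ereal_integral (restrict_space lborel {a..b}) (\<lambda>x. ereal (g x)) = ereal (integral {a..b} g)"
proof -
  let ?M = "restrict_space lborel {a..b}"
  have si: "set_integrable lborel {a..b} g"
    using borel_integrable_atLeastAtMost'[OF g] .
  then have i: "integrable ?M g"
    by (simp add: set_integrable_def integrable_restrict_space)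
  have fin: "(\<integral>\<^sup>+ x. ennreal (g x) \<partial>?M) < \<infinity>" "(\<integral>\<^sup>+ x. ennreal (- g x) \<partial>?M) < \<infinity>"
    using i by (auto simp: real_integrable_def less_top)
  obtain r s where rs: "(\<integral>\<^sup>+ x. ennreal (g x) \<partial>?M) = ennreal r" "r \<ge> 0"
    "(\<integral>\<^sup>+ x. ennreal (- g x) \<partial>?M) = ennreal s" "s \<ge> 0"
    using fin by (metis ennreal_cases infinity_ennreal_def less_irrefl)
  have "integral {a..b} g = integral\<^sup>L ?M g"
    using set_borel_integral_eq_integral(2)[OF si]
    by (simp add: set_lebesgue_integral_def integral_restrict_space)
  also have "\<dots> = r - s"
    using rs by (simp add: real_lebesgue_integral_def[OF i])
  finally show ?thesis using rs by (simp add: ereal_integral_def)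
qed

lemma circle_mean_real:
  assumes "\<And>l. cmod l = 1 \<Longrightarrow> z + l *\<^sub>C h \<in> S" "continuous_on S u"
  shows "circle_mean (\<lambda>z. ereal (u z)) z h =
    ereal (integral {0..2*pi} (\<lambda>\<theta>. u (z + cis \<theta> *\<^sub>C h)) / (2 * pi))"
proof -
  have "continuous_on {0..2*pi} (\<lambda>\<theta>. u (z + cis \<theta> *\<^sub>C h))"
  proof (rule continuous_on_compose2[OF assms(2)])
    show "continuous_on {0..2*pi} (\<lambda>\<theta>. z + cis \<theta> *\<^sub>C h)"
      by (intro continuous_intros bounded_linear.continuous_on[OF bounded_linear_scaleC_left])
  qed (use assms(1) in auto)
  then show ?thesis by (simp add: circle_mean_def ereal_integral_continuous)
qed

section \<open>Plurisubharmonicity and the maximum principle\<close>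

lemma C2_fun_lincomb:
  assumes "C2_fun \<Omega> u u1 u2" "C2_fun \<Omega> v v1 v2"
  shows "C2_fun \<Omega> (\<lambda>z. a * u z + b * v z) (\<lambda>z. a *\<^sub>R u1 z + b *\<^sub>R v1 z) (\<lambda>z. a *\<^sub>R u2 z + b *\<^sub>R v2 z)"
proof -
  interpret u: C2_fun \<Omega> u u1 u2 by fact
  interpret v: C2_fun \<Omega> v v1 v2 by fact
  show ?thesis
  proof
    fix z assume z: "z \<in> \<Omega>"
    show "((\<lambda>z. a * u z + b * v z) has_derivative blinfun_apply (a *\<^sub>R u1 z + b *\<^sub>R v1 z)) (at z)"
      by (auto intro!: derivative_eq_intros u.deriv1 v.deriv1 z simp: blinfun.add_left blinfun.scaleR_left)
    show "((\<lambda>z. a *\<^sub>R u1 z + b *\<^sub>R v1 z) has_derivative blinfun_apply (a *\<^sub>R u2 z + b *\<^sub>R v2 z)) (at z)"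
      by (auto intro!: derivative_eq_intros u.deriv2 v.deriv2 z simp: blinfun.add_left blinfun.scaleR_left)
  qed (intro continuous_intros u.cont2 v.cont2 u.open_domain)+
qed

definition norm_sq_D2 :: "'a::real_inner \<Rightarrow>\<^sub>L 'a \<Rightarrow>\<^sub>L real"
  where "norm_sq_D2 = 2 *\<^sub>R Blinfun blinfun_inner_right"

lemma norm_sq_D2_apply: "norm_sq_D2 s t = 2 * inner s t"
  by (simp add: norm_sq_D2_def blinfun.scaleR_left
      bounded_linear_Blinfun_apply[OF bounded_linear_blinfun_inner_right])

lemma C2_fun_norm_sq:
  fixes \<Omega> :: "'a::real_inner set"
  assumes "open \<Omega>"
  shows "C2_fun \<Omega> (\<lambda>z. (norm (z - a))\<^sup>2) (\<lambda>z. norm_sq_D2 (z - a)) (\<lambda>z. norm_sq_D2)"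
proof
  fix z :: 'a
  show "((\<lambda>z. (norm (z - a))\<^sup>2) has_derivative blinfun_apply (norm_sq_D2 (z - a))) (at z)"
    unfolding power2_norm_eq_inner
    by (auto intro!: derivative_eq_intros simp: norm_sq_D2_apply inner_commute)
  have "((\<lambda>z. norm_sq_D2 (z - a)) has_derivative (\<lambda>s. norm_sq_D2 (s - 0))) (at z)"
    by (intro bounded_linear.has_derivative[OF blinfun.bounded_linear_right] derivative_intros)
  then show "((\<lambda>z. norm_sq_D2 (z - a)) has_derivative blinfun_apply norm_sq_D2) (at z)" by simp
qed (use assms in auto)

lemma second_derivative_test_max:
  fixes f f' :: "real \<Rightarrow> real"
  assumes d: "d > 0" and f: "\<And>t. \<bar>t\<bar> < d \<Longrightarrow> (f has_real_derivative f' t) (at t)"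
    and f': "(f' has_real_derivative c) (at 0)" and max: "\<And>t. \<bar>t\<bar> < d \<Longrightarrow> f t \<le> f 0"
  shows "c \<le> 0"
proof (rule ccontr)
  assume "\<not> c \<le> 0"
  then have c: "c > 0" by simp
  have f0: "f' 0 = 0"
    by (rule DERIV_local_max[OF f d]) (use d max in auto)
  from DERIV_pos_inc_right[OF f' c] f0
  obtain k where k: "k > 0" "\<And>h. h > 0 \<Longrightarrow> h < k \<Longrightarrow> 0 < f' h" by auto
  define t where "t = min d k / 2"
  have t: "0 < t" "t < d" "t < k" using d k by (auto simp: t_def)
  have "\<exists>s. 0 < s \<and> s < t \<and> f t - f 0 = (t - 0) * f' s"
    by (rule MVT2[OF t(1)]) (use t f in auto)
  then obtain s where s: "0 < s" "s < t" "f t - f 0 = t * f' s" by auto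
  have "f' s > 0" using k s t by simp
  then have "t * f' s > 0" using t by simp
  moreover have "f t \<le> f 0" using max t by simp
  ultimately show False using s by simp
qed

context C2_fun_complex begin

lemma lap_cont: "continuous_on \<Omega> (\<lambda>z. lap z s)"
  unfolding lap_def by (intro continuous_intros cont2)

lemma lap_nonpos_at_local_max:
  assumes z: "z \<in> \<Omega>" and d: "d > 0"
    and max: "\<And>l. cmod l < d \<Longrightarrow> z + l *\<^sub>C h \<in> \<Omega> \<and> u (z + l *\<^sub>C h) \<le> u z"
  shows "lap z h \<le> 0"
proof -
  have dir: "u2 z (w *\<^sub>C h) (w *\<^sub>C h) \<le> 0" if w: "cmod w = 1" for w
  proof -
    define \<gamma> where "\<gamma> t = z + t *\<^sub>R (w *\<^sub>C h)" for t
    have g_alt: "\<gamma> t = z + (complex_of_real t * w) *\<^sub>C h" for t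
      by (simp add: \<gamma>_def scaleR_scaleC scaleC_scaleC)
    have g: "(\<gamma> has_vector_derivative w *\<^sub>C h) (at t)" for t
      unfolding \<gamma>_def by (auto intro!: derivative_eq_intros)
    have m: "\<gamma> t \<in> \<Omega> \<and> u (\<gamma> t) \<le> u z" if "\<bar>t\<bar> < d" for t
      unfolding g_alt using that w by (intro max) (simp add: norm_mult)
    show ?thesis
    proof (rule second_derivative_test_max[OF d, of "\<lambda>t. u (\<gamma> t)" "\<lambda>t. u1 (\<gamma> t) (w *\<^sub>C h)"])
      show "((\<lambda>t. u (\<gamma> t)) has_real_derivative u1 (\<gamma> t) (w *\<^sub>C h)) (at t)" if "\<bar>t\<bar> < d" for t
        using m[OF that] by (intro deriv_along_curve g) simp
      have "((\<lambda>t. u1 (\<gamma> t) (w *\<^sub>C h)) has_real_derivative u2 (\<gamma> 0) (w *\<^sub>C h) (w *\<^sub>C h) + u1 (\<gamma> 0) 0) (at 0)"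
        by (rule deriv1_along_curve[OF g _ has_vector_derivative_const]) (use m[of 0] d in simp)
      then show "((\<lambda>t. u1 (\<gamma> t) (w *\<^sub>C h)) has_real_derivative u2 z (w *\<^sub>C h) (w *\<^sub>C h)) (at 0)"
        by (simp add: \<gamma>_def)
      show "u (\<gamma> t) \<le> u (\<gamma> 0)" if "\<bar>t\<bar> < d" for t using m[OF that] by (simp add: \<gamma>_def)
    qed
  qed
  show ?thesis using dir[of 1] dir[of \<i>] by (simp add: lap_def)
qed

lemma psh_of_lap_nonneg:
  assumes lap: "\<And>z s. z \<in> \<Omega> \<Longrightarrow> lap z s \<ge> 0"
  shows "psh \<Omega> (\<lambda>z. ereal (u z))"
  unfolding psh_def
proof (intro conjI ballI allI impI)
  show "usc_on \<Omega> (\<lambda>z. ereal (u z))"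
    unfolding usc_on_def
  proof
    fix c
    have "continuous_on \<Omega> (\<lambda>z. ereal (u z))" by (intro continuous_intros cont0)
    from continuous_openin_preimage_gen[OF this open_lessThan[of c]]
    show "openin (top_of_set \<Omega>) {z \<in> \<Omega>. ereal (u z) < c}"
      by (simp add: vimage_def Int_def)
  qed
next
  fix C assume "C \<in> components \<Omega>"
  then show "\<exists>z\<in>C. ereal (u z) \<noteq> - \<infinity>" using in_components_nonempty by fastforce
next
  fix z h assume z: "z \<in> \<Omega>" and disc: "\<forall>l. cmod l \<le> 1 \<longrightarrow> z + l *\<^sub>C h \<in> \<Omega>"
  have "u z + 0 / 4 \<le> integral {0..2*pi} (\<lambda>\<theta>. u (z + cis \<theta> *\<^sub>C h)) / (2 * pi)"
    by (rule mean_value_gap) (use disc lap in auto)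
  then show "ereal (u z) \<le> circle_mean (\<lambda>z. ereal (u z)) z h"
    using disc by (subst circle_mean_real[OF _ cont0]) auto
qed simp

text \<open>
  If the Laplacian along \<open>s\<close> were negative at \<open>z\<close>, it would by continuity be at most half that value
  on a small disc through \<open>z\<close> in the direction \<open>s\<close>. The strict mean value inequality for \<open>-u\<close> on this
  disc contradicts the sub-mean-value inequality of \<open>u\<close>.
\<close>

lemma lap_nonneg_of_psh:
  assumes psh: "psh \<Omega> (\<lambda>z. ereal (u z))" and z: "z \<in> \<Omega>"
  shows "lap z s \<ge> 0"
proof (rule ccontr)
  assume "\<not> lap z s \<ge> 0"
  then have neg: "lap z s < 0" by simp
  have "isCont (\<lambda>p. lap p s) z"
    using lap_cont[of s] z open_domain continuous_on_eq_continuous_at by blast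
  then obtain r1 where r1: "r1 > 0" "\<And>p. dist p z < r1 \<Longrightarrow> dist (lap p s) (lap z s) < - lap z s / 2"
    unfolding continuous_at_eps_delta using neg by (metis half_gt_zero neg_0_less_iff_less)
  obtain r2 where r2: "r2 > 0" "ball z r2 \<subseteq> \<Omega>" using open_domain z open_contains_ball by blast
  \<comment> \<open>small enough that the disc \<open>z + l h\<close>, \<open>\<bar>l\<bar> \<le> 1\<close>, stays in both balls\<close>
  define \<tau> where "\<tau> = min r1 r2 / (2 * (norm s + 1))"
  have N: "norm s + 1 > 0" by (simp add: add_nonneg_pos)
  have \<tau>: "\<tau> > 0" using r1 r2 N by (simp add: \<tau>_def)
  have "\<tau> * norm s < \<tau> * (2 * (norm s + 1))" using \<tau> by (intro mult_strict_left_mono) (auto intro: add_nonneg_pos)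
  also have "\<dots> = min r1 r2" using N by (simp add: \<tau>_def)
  finally have small: "\<tau> * norm s < min r1 r2" .
  define h where "h = complex_of_real \<tau> *\<^sub>C s"
  have h: "norm h < min r1 r2" using small \<tau> by (simp add: h_def)
  have near: "dist (z + l *\<^sub>C h) z < min r1 r2" if "cmod l \<le> 1" for l
    using mult_right_mono[OF that norm_ge_zero[of h]] h by (simp add: dist_norm)
  have disc: "z + l *\<^sub>C h \<in> \<Omega>" if "cmod l \<le> 1" for l
    using near[OF that] r2 by (auto simp: dist_commute)
  define c where "c = - \<tau>\<^sup>2 * (lap z s / 2)"
  have c: "c > 0" using neg \<tau> by (simp add: c_def mult_pos_neg)
  interpret m: C2_fun_complex \<Omega> "\<lambda>z. - 1 * u z + 0 * u z" "\<lambda>z. - 1 *\<^sub>R u1 z + 0 *\<^sub>R u1 z" "\<lambda>z. - 1 *\<^sub>R u2 z + 0 *\<^sub>R u2 z"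
    unfolding C2_fun_complex_def by (intro C2_fun_lincomb C2_fun_axioms)
  have mlap: "m.lap p v = - lap p v" for p v
    unfolding m.lap_def lap_def by (simp add: blinfun.minus_left)
  have gap: "c \<le> m.lap (z + l *\<^sub>C h) h" if "cmod l \<le> 1" for l
  proof -
    have "lap (z + l *\<^sub>C h) s \<le> lap z s / 2"
      using r1(2)[of "z + l *\<^sub>C h"] near[OF that] by (auto simp: dist_real_def abs_less_iff)
    then have "\<tau>\<^sup>2 * lap (z + l *\<^sub>C h) s \<le> \<tau>\<^sup>2 * (lap z s / 2)" by (simp only: mult_left_mono zero_le_power2)
    moreover have "lap p h = \<tau>\<^sup>2 * lap p s" for p by (simp add: h_def lap_scaleC)
    ultimately show ?thesis unfolding mlap c_def by simp
  qed
  have "- 1 * u z + 0 * u z + c / 4 \<le> integral {0..2*pi} (\<lambda>\<theta>. - 1 * u (z + cis \<theta> *\<^sub>C h) + 0 * u (z + cis \<theta> *\<^sub>C h)) / (2 * pi)"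
    by (rule m.mean_value_gap) (use disc gap in auto)
  then have 1: "integral {0..2*pi} (\<lambda>\<theta>. u (z + cis \<theta> *\<^sub>C h)) / (2 * pi) < u z" using c by simp
  have "ereal (u z) \<le> circle_mean (\<lambda>z. ereal (u z)) z h"
    using psh z disc unfolding psh_def by blast
  also have "\<dots> = ereal (integral {0..2*pi} (\<lambda>\<theta>. u (z + cis \<theta> *\<^sub>C h)) / (2 * pi))"
    by (rule circle_mean_real[OF _ cont0]) (use disc in auto)
  finally show False using 1 by simp
qed

text \<open>
  On the slice of the closure by a complex line through \<open>z\<^sub>0\<close>, which is compact, the function
  \<open>u + \<delta> \<parallel>z - z\<^sub>0\<parallel>\<^sup>2\<close> attains its maximum. The term with \<open>\<delta>\<close> makes the Laplacian strictly positive, so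
  the maximum is not attained inside; and \<open>\<delta>\<close> is so small that a positive value at \<open>z\<^sub>0\<close> exceeds all
  the values on the boundary.
\<close>

lemma maximum_principle:
  assumes bdd: "bounded \<Omega>" and cont: "continuous_on (closure \<Omega>) u"
    and lap: "\<And>z s. z \<in> \<Omega> \<Longrightarrow> lap z s \<ge> 0"
    and front: "\<And>z. z \<in> frontier \<Omega> \<Longrightarrow> u z \<le> 0"
    and z0: "z0 \<in> \<Omega>" and nz: "\<exists>x::'a. x \<noteq> 0"
  shows "u z0 \<le> 0"
proof (rule ccontr)
  assume "\<not> u z0 \<le> 0"
  then have pos: "u z0 > 0" by simp
  obtain h :: 'a where h: "norm h = 1" using nz by (metis norm_sgn)
  obtain R where R: "R > 0" "\<And>z. z \<in> closure \<Omega> \<Longrightarrow> norm (z - z0) \<le> R"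
  proof -
    have "bounded ((\<lambda>z. z - z0) ` closure \<Omega>)"
      using bounded_translation[of "closure \<Omega>" "- z0"] bdd by (simp add: bounded_closure)
    then show thesis using that by (auto simp: bounded_pos)
  qed
  define \<delta> where "\<delta> = u z0 / (2 * R\<^sup>2)"
  have \<delta>: "\<delta> > 0" "\<delta> * R\<^sup>2 < u z0" using pos R by (auto simp: \<delta>_def)
  interpret V: C2_fun_complex \<Omega> "\<lambda>z. 1 * u z + \<delta> * (norm (z - z0))\<^sup>2"
    "\<lambda>z. 1 *\<^sub>R u1 z + \<delta> *\<^sub>R norm_sq_D2 (z - z0)" "\<lambda>z. 1 *\<^sub>R u2 z + \<delta> *\<^sub>R norm_sq_D2"
    unfolding C2_fun_complex_def by (intro C2_fun_lincomb C2_fun_axioms C2_fun_norm_sq open_domain)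
  define W where "W z = 1 * u z + \<delta> * (norm (z - z0))\<^sup>2" for z
  define S where "S = {l. z0 + l *\<^sub>C h \<in> closure \<Omega>}"
  have cl: "continuous_on T (\<lambda>l. z0 + l *\<^sub>C h)" for T
    by (intro continuous_intros bounded_linear.continuous_on[OF bounded_linear_scaleC_left])
  have "closed S"
    unfolding S_def using continuous_closed_preimage[OF cl closed_UNIV closed_closure[of \<Omega>]]
    by (simp add: vimage_def)
  moreover have "bounded S"
    unfolding bounded_iff S_def using R(2) h by (auto intro!: exI[of _ R] dest!: R(2))
  ultimately have "compact S" by (simp add: compact_eq_bounded_closed)
  moreover have S0: "0 \<in> S" using z0 closure_subset by (auto simp: S_def scaleC_0)
  moreover have "continuous_on S (\<lambda>l. W (z0 + l *\<^sub>C h))"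
  proof (rule continuous_on_compose2[OF _ cl])
    show "continuous_on (closure \<Omega>) W" unfolding W_def by (intro continuous_intros cont)
  qed (auto simp: S_def)
  ultimately obtain k where k: "k \<in> S" "\<And>l. l \<in> S \<Longrightarrow> W (z0 + l *\<^sub>C h) \<le> W (z0 + k *\<^sub>C h)"
    using continuous_attains_sup[of S "\<lambda>l. W (z0 + l *\<^sub>C h)"] by blast
  define p where "p = z0 + k *\<^sub>C h"
  have pcl: "p \<in> closure \<Omega>" using k(1) by (simp add: S_def p_def)
  have big: "u z0 \<le> W p" using k(2)[OF S0] by (simp add: W_def p_def scaleC_0)
  have "p \<in> \<Omega>"
  proof (rule ccontr)
    assume "p \<notin> \<Omega>"
    then have "p \<in> frontier \<Omega>" using pcl open_domain by (simp add: frontier_def interior_open)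
    then have "u p \<le> 0" by (rule front)
    moreover have "\<delta> * (norm (p - z0))\<^sup>2 \<le> \<delta> * R\<^sup>2"
      using R(2)[OF pcl] \<delta> by (simp add: power_mono)
    ultimately show False using big \<delta>(2) unfolding W_def by linarith
  qed
  have "open {l. p + l *\<^sub>C h \<in> \<Omega>}"
  proof -
    have "continuous_on UNIV (\<lambda>l. p + l *\<^sub>C h)"
      by (intro continuous_intros bounded_linear.continuous_on[OF bounded_linear_scaleC_left])
    from continuous_open_preimage[OF this open_UNIV open_domain] show ?thesis by (simp add: vimage_def)
  qed
  moreover have "0 \<in> {l. p + l *\<^sub>C h \<in> \<Omega>}" using \<open>p \<in> \<Omega>\<close> by (simp add: scaleC_0)
  ultimately obtain d where d: "d > 0" "\<And>l. cmod l < d \<Longrightarrow> p + l *\<^sub>C h \<in> \<Omega>"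
    unfolding open_contains_ball by (auto simp: subset_iff)
  have "V.lap p h \<le> 0"
  proof (rule V.lap_nonpos_at_local_max[OF \<open>p \<in> \<Omega>\<close> d(1)])
    fix l assume l: "cmod l < d"
    have eq: "p + l *\<^sub>C h = z0 + (k + l) *\<^sub>C h" by (simp add: p_def scaleC_add_left)
    have "k + l \<in> S" using d(2)[OF l] closure_subset unfolding S_def eq by auto
    from k(2)[OF this] d(2)[OF l]
    show "p + l *\<^sub>C h \<in> \<Omega> \<and> 1 * u (p + l *\<^sub>C h) + \<delta> * (norm (p + l *\<^sub>C h - z0))\<^sup>2
        \<le> 1 * u p + \<delta> * (norm (p - z0))\<^sup>2"
      unfolding W_def p_def[symmetric] eq[symmetric] by simp
  qed
  moreover have "V.lap p h = lap p h + 4 * \<delta>"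
  proof -
    have "inner h h = 1" "inner (\<i> *\<^sub>C h) (\<i> *\<^sub>C h) = 1"
      using h by (simp_all add: power2_norm_eq_inner[symmetric])
    then show ?thesis
      unfolding V.lap_def lap_def
      by (simp add: blinfun.add_left blinfun.scaleR_left norm_sq_D2_apply)
  qed
  ultimately show False using lap[OF \<open>p \<in> \<Omega>\<close>, of h] \<delta> by simp
qed

end

theorem theorem6p4:
  fixes \<Omega> :: "'a::complex_hilbert set" and u :: "'a \<Rightarrow> real"
  assumes nonzero: "\<exists>x::'a. x \<noteq> 0"
    and domain: "open \<Omega>" "connected \<Omega>" "\<Omega> \<noteq> {}"
    and bounded_domain: "bounded \<Omega>"
    and psh_u: "psh \<Omega> (\<lambda>z. ereal (u z))"
    and C2_u: "C2_closure \<Omega> u"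
    and bounded_u: "bounded (u ` closure \<Omega>)"
    and boundary: "\<forall>z\<in>frontier \<Omega>. u z \<ge> (norm z)\<^sup>2"
    and det: "\<forall>z\<in>\<Omega>. \<forall>x. norm x = 1 \<longrightarrow>
      fujii_seo_det x (levi_op u z) \<le> fujii_seo_det x id_blinfun"
  shows "psh \<Omega> (\<lambda>z. ereal ((norm z)\<^sup>2 - u z)) \<and> (\<forall>z\<in>\<Omega>. (norm z)\<^sup>2 - u z \<le> 0)"
proof -
  obtain u1 u2 where d1: "\<And>z. z \<in> \<Omega> \<Longrightarrow> (u has_derivative blinfun_apply (u1 z)) (at z)"
    and d2: "\<And>z. z \<in> \<Omega> \<Longrightarrow> (u1 has_derivative blinfun_apply (u2 z)) (at z)"
    and cu: "continuous_on (closure \<Omega>) u" and cu2: "continuous_on (closure \<Omega>) u2"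
    using C2_u unfolding C2_closure_def by blast
  interpret u: C2_fun_complex \<Omega> u u1 u2
    using domain(1) d1 d2 continuous_on_subset[OF cu2 closure_subset] by unfold_locales auto
  \<comment> \<open>\<open>\<parallel>z\<parallel>\<^sup>2 - u\<close>, written in the shape in which \<open>C2_fun_lincomb\<close> produces it\<close>
  interpret v: C2_fun_complex \<Omega> "\<lambda>z. 1 * (norm (z - 0))\<^sup>2 + (- 1) * u z"
    "\<lambda>z. 1 *\<^sub>R norm_sq_D2 (z - 0) + (- 1) *\<^sub>R u1 z" "\<lambda>z. 1 *\<^sub>R norm_sq_D2 + (- 1) *\<^sub>R u2 z"
    unfolding C2_fun_complex_def by (intro C2_fun_lincomb C2_fun_norm_sq u.C2_fun_axioms domain)
  have lap_u: "0 \<le> u.lap z s" if "z \<in> \<Omega>" for z s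
    using psh_u that by (rule u.lap_nonneg_of_psh)
  have lap_v: "0 \<le> v.lap z s" if z: "z \<in> \<Omega>" for z s
  proof -
    interpret A: positive_op "levi_op u z"
      using z lap_u[OF z] by (rule u.levi_op_positive)
    have "inner (levi_op u z s) s \<le> (norm s)\<^sup>2"
      by (rule A.form_le_of_fujii_seo_det_le_one) (use det z fujii_seo_det_id in fastforce)
    then have "u.lap z s \<le> 4 * (norm s)\<^sup>2" using u.levi_op_form[OF z, of s] by simp
    moreover have "v.lap z s = 4 * (norm s)\<^sup>2 - u.lap z s"
    proof -
      have "inner (\<i> *\<^sub>C s) (\<i> *\<^sub>C s) = inner s s"
        by (simp add: power2_norm_eq_inner[symmetric])
      then show ?thesis
        unfolding v.lap_def u.lap_def
        by (simp add: blinfun.diff_left norm_sq_D2_apply power2_norm_eq_inner)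
    qed
    ultimately show ?thesis by simp
  qed
  have "psh \<Omega> (\<lambda>z. ereal ((norm z)\<^sup>2 - u z))"
    using v.psh_of_lap_nonneg lap_v by simp
  moreover have "(norm z)\<^sup>2 - u z \<le> 0" if z: "z \<in> \<Omega>" for z
  proof -
    have "1 * (norm (z - 0))\<^sup>2 + (- 1) * u z \<le> 0"
      by (rule v.maximum_principle[OF bounded_domain _ lap_v _ z nonzero])
         (use boundary in \<open>auto intro!: continuous_intros cu\<close>)
    then show ?thesis by simp
  qed
  ultimately show ?thesis by blast
qed

end
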